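(* Let $K$ be a number field, $\ell$ a prime number, and $G$ a torsion-free subgroup of $K^\times$ of finite rank $r>0$. Let $z=v_\ell(\#K^\times_{\mathrm{tors}})$. Suppose $G=\langle b_1,\ldots,b_r\rangle$ with $b_i=B_i^{\ell^{d_i}}\zeta_i$, where $d_i,h_i$ are nonnegative integers, $B_1,\ldots,B_r\in K^\times$ are strongly $\ell$-independent and $\zeta_i\in K$ is a root of unity of order $\ell^{h_i}$. Let $n$ be a nonnegative integer, write $\delta_i=\max(n-d_i,0)$, let $G_n=G\cap(K^\times)^{\ell^n}$, and let $H_n$ be the subgroup of $G/G_n$ generated by the classes of $b_1^{\ell^{\delta_1}},\ldots,b_r^{\ell^{\delta_r}}$. Then $H_n$ is a finite cyclic $\ell$-group with $$v_\ell(\#H_n)=\max(h_1-\delta_1,\ldots,h_r-\delta_r,z-n,0)+\min(n-z,0),$$ and $$\frac{G/G_n}{H_n}\cong\bigoplus_{i=1}^r\frac{\mathbb Z}{\ell^{\delta_i}\mathbb Z}.$$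
   Context: $K^\times_{\mathrm{tors}}$ is the group of roots of unity in $K$, $v_\ell$ the $\ell$-adic valuation on $\mathbb Z$, and $(K^\times)^{k}=\{x^k:x\in K^\times\}$. An element $a\in K^\times$ is strongly $\ell$-indivisible if there is no root of unity $\zeta\in K$ of $\ell$-power order with $a\zeta\in(K^\times)^\ell$. Elements $a_1,\ldots,a_r\in K^\times$ are strongly $\ell$-independent if $a_1^{x_1}\cdots a_r^{x_r}$ is strongly $\ell$-indivisible whenever $x_1,\ldots,x_r$ are integers not all divisible by $\ell$. *)

theory Defs
  imports "HOL-Algebra.Algebra" "HOL-Algebra.Multiplicative_Group"
    "HOL-Algebra.Elementary_Groups" "HOL-Algebra.Product_Groups"
    "HOL-Algebra.Algebraic_Closure_Type"
    "HOL-Computational_Algebra.Factorial_Ring" "HOL-Computational_Algebra.Primes"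
begin

hide_const (open) Ring_Divisibility.mult_of Divisibility.prime

(* Here ring_of_type_algebra, taken at type rat, is the field of rational numbers as a record. *)
definition number_field :: "('a, 'b) ring_scheme \<Rightarrow> bool" where
  "number_field K \<longleftrightarrow> field K \<and>
     (\<exists>\<phi> \<in> ring_hom (ring_of_type_algebra :: rat ring) K.
        ring.finite_dimension K (range \<phi>) (carrier K))"

definition torsion_set :: "('a, 'b) monoid_scheme \<Rightarrow> 'a set" where
  "torsion_set A = {x \<in> carrier A. \<exists>n::nat. 0 < n \<and> x [^]\<^bsub>A\<^esub> n = \<one>\<^bsub>A\<^esub>}"

definition torsion_free :: "('a, 'b) monoid_scheme \<Rightarrow> bool" where
  "torsion_free A \<longleftrightarrow> torsion_set A = {\<one>\<^bsub>A\<^esub>}"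

definition int_independent :: "('a, 'b) monoid_scheme \<Rightarrow> 'a set \<Rightarrow> bool" where
  "int_independent A S \<longleftrightarrow> finite S \<and> S \<subseteq> carrier A \<and>
     (\<forall>x :: 'a \<Rightarrow> int. (\<Otimes>\<^bsub>A\<^esub>s\<in>S. s [^]\<^bsub>A\<^esub> x s) = \<one>\<^bsub>A\<^esub> \<longrightarrow> (\<forall>s\<in>S. x s = 0))"

(* The abelian group A has finite rank r: r is the largest size of an independent subset. *)
definition has_rank :: "('a, 'b) monoid_scheme \<Rightarrow> nat \<Rightarrow> bool" where
  "has_rank A r \<longleftrightarrow> (\<exists>S. int_independent A S \<and> card S = r) \<and>
     (\<forall>S. int_independent A S \<longrightarrow> card S \<le> r)"

definition powers :: "('a, 'b) monoid_scheme \<Rightarrow> nat \<Rightarrow> 'a set" where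
  "powers A k = (\<lambda>x. x [^]\<^bsub>A\<^esub> k) ` carrier A"

(* group.ord is 0 on elements of infinite order, so an order l ^ k with l prime is
   a genuine order; k = 0 (the root of unity 1) is allowed. *)
definition strongly_indivisible :: "('a, 'b) ring_scheme \<Rightarrow> nat \<Rightarrow> 'a \<Rightarrow> bool" where
  "strongly_indivisible K l a \<longleftrightarrow> a \<in> carrier (mult_of K) \<and>
     \<not> (\<exists>\<zeta> \<in> carrier (mult_of K). (\<exists>k. group.ord (mult_of K) \<zeta> = l ^ k) \<and>
          a \<otimes>\<^bsub>K\<^esub> \<zeta> \<in> powers (mult_of K) l)"

definition strongly_independent ::
    "('a, 'b) ring_scheme \<Rightarrow> nat \<Rightarrow> nat \<Rightarrow> (nat \<Rightarrow> 'a) \<Rightarrow> bool" where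
  "strongly_independent K l r a \<longleftrightarrow> (\<forall>i\<in>{1..r}. a i \<in> carrier (mult_of K)) \<and>
     (\<forall>x :: nat \<Rightarrow> int. (\<exists>i\<in>{1..r}. \<not> int l dvd x i) \<longrightarrow>
        strongly_indivisible K l
          (\<Otimes>\<^bsub>mult_of K\<^esub>i\<in>{1..r}. a i [^]\<^bsub>mult_of K\<^esub> x i))"

end

theory Submission
  imports Defs "HOL-Computational_Algebra.Fundamental_Theorem_Algebra"
begin

text \<open>
  Since \<open>d\<^sub>i + \<delta>\<^sub>i \<ge> n\<close>, the class of \<open>b\<^sub>i ^ (l ^ \<delta>\<^sub>i)\<close> modulo \<open>l ^ n\<close>-th powers is that of the root
  of unity \<open>\<zeta>\<^sub>i ^ (l ^ \<delta>\<^sub>i)\<close>. These all lie in the cyclic group of roots of unity of \<open>l\<close>-power order,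
  so the one of largest order \<open>l ^ m\<close> generates \<open>H\<^sub>n\<close>; as an \<open>l ^ n\<close>-th power is a root of unity of
  \<open>l\<close>-power order only if its base is, \<open>H\<^sub>n\<close> has order \<open>l ^ max (m - max (z - n) 0) 0\<close>.
  Conversely, strong independence of the \<open>B\<^sub>i\<close> gives, by descent on \<open>n\<close>, that a product of powers of the
  \<open>b\<^sub>i\<close> with exponents \<open>x\<^sub>i\<close> lies in \<open>H\<^sub>n\<close> only if \<open>l ^ \<delta>\<^sub>i\<close> divides every \<open>x\<^sub>i\<close>. So the second quotient
  and the direct sum are quotients of \<open>\<int>\<^sup>r\<close> by the same subgroup.

  The valuation \<open>z\<close> is meaningful because a number field has finitely many roots of unity: a
  primitive integer polynomial of minimal degree vanishing at such a root divides some \<open>X ^ N - 1\<close>, so its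
  complex roots have modulus 1 and its coefficients are bounded in terms of the degree of the field.
\<close>

section \<open>Integer polynomials dividing \<open>X ^ N - 1\<close>\<close>

text \<open>Multiplication by X - a shifts the coefficients and subtracts a times the old ones, so
  for a of norm at most 1 it at most doubles a bound on them.\<close>

lemma norm_coeff_prod_linear_le:
  fixes R :: "complex multiset"
  assumes "\<And>x. x \<in># R \<Longrightarrow> norm x \<le> 1"
  shows "norm (coeff (\<Prod>x\<in>#R. [:- x, 1:]) k) \<le> 2 ^ size R"
  using assms
proof (induction R arbitrary: k)
  case empty
  show ?case by simp
next
  case (add a R)
  let ?p = "\<Prod>x\<in>#R. [:- x, 1:]"
  have IH: "norm (coeff ?p j) \<le> 2 ^ size R" for j
    using add.IH add.prems by simp
  have "norm a * norm (coeff ?p k) \<le> 1 * 2 ^ size R"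
    by (rule mult_mono) (use add IH in auto)
  moreover have "norm (coeff (pCons 0 ?p) k) \<le> 2 ^ size R"
    using IH by (cases k) auto
  moreover have "coeff (\<Prod>x\<in>#add_mset a R. [:- x, 1:]) k = coeff (pCons 0 ?p) k - a * coeff ?p k"
    by simp
  ultimately show ?case
    using norm_triangle_ineq4[of "coeff (pCons 0 ?p) k" "a * coeff ?p k"]
    by (simp add: norm_mult)
qed

lemma finite_bounded_int_polys:
  "finite {p :: int poly. degree p \<le> D \<and> (\<forall>k. \<bar>coeff p k\<bar> \<le> M)}" (is "finite ?S")
proof (rule finite_subset)
  let ?L = "{xs. set xs \<subseteq> {- M..M} \<and> length xs \<le> Suc D}"
  show "?S \<subseteq> Poly ` ?L"
  proof
    fix p assume p: "p \<in> ?S"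
    have "set (coeffs p) \<subseteq> {- M..M}"
    proof
      fix a assume "a \<in> set (coeffs p)"
      then obtain k where "a = coeff p k"
        by (auto simp: coeffs_def split: if_splits)
      moreover have "\<bar>coeff p k\<bar> \<le> M" using p by blast
      ultimately show "a \<in> {- M..M}" by auto
    qed
    moreover have "length (coeffs p) \<le> Suc D"
      using p by (simp add: coeffs_def)
    ultimately have "coeffs p \<in> ?L" by simp
    then show "p \<in> Poly ` ?L" using imageI[of "coeffs p" ?L Poly] by (simp only: Poly_coeffs)
  qed
  show "finite (Poly ` ?L)"
    by (rule finite_imageI, rule finite_lists_length_le) simp
qed

lemma map_poly_of_int_mult:
  "map_poly of_int (p * q) = (map_poly of_int p * map_poly of_int q :: 'a :: comm_ring_1 poly)"
  by (rule poly_eqI) (simp add: coeff_map_poly coeff_mult)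

definition unity_poly :: "nat \<Rightarrow> int poly"
  where "unity_poly N = Polynomial.monom 1 N - 1"

lemma coeff_unity_poly:
  "N > 0 \<Longrightarrow> coeff (unity_poly N) k = (if k = N then 1 else if k = 0 then -1 else 0)"
  by (auto simp: unity_poly_def coeff_1)

text \<open>The leading coefficient of \<open>p\<close> divides that of X ^ N - 1, so it is 1 or -1,
  and the complex roots of \<open>p\<close> are \<open>N\<close>-th roots of unity. Splitting
  \<open>p\<close> into linear factors over the complex numbers then gives the bound. It does not
  depend on \<open>N\<close>, which is what the finiteness argument for the torsion relies
  on.\<close>

lemma coeff_bound_of_dvd_unity_poly:
  fixes p :: "int poly"
  assumes "p dvd unity_poly N" and "N > 0"
  shows "\<bar>coeff p k\<bar> \<le> 2 ^ degree p"
proof -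
  let ?f = "map_poly of_int :: int poly \<Rightarrow> complex poly"
  obtain q where q: "unity_poly N = p * q" using assms by blast
  have "degree (unity_poly N) \<le> N"
    by (rule degree_le) (simp add: coeff_unity_poly \<open>N > 0\<close>)
  moreover have "N \<le> degree (unity_poly N)"
    by (rule le_degree) (simp add: coeff_unity_poly \<open>N > 0\<close>)
  ultimately have "degree (unity_poly N) = N" by simp
  then have "lead_coeff (unity_poly N) = 1"
    using \<open>N > 0\<close> by (simp add: coeff_unity_poly)
  then have "lead_coeff p * lead_coeff q = 1" by (simp add: q lead_coeff_mult)
  then have "lead_coeff p dvd 1" by (rule dvdI[OF sym])
  then have lead: "\<bar>lead_coeff p\<bar> = 1" by simp
  have eq: "?f p * ?f q = monom 1 N - 1"
  proof -
    have "?f p * ?f q = ?f (unity_poly N)" by (simp only: map_poly_of_int_mult q)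
    also have "\<dots> = monom 1 N - 1"
      by (rule poly_eqI) (simp add: coeff_map_poly unity_poly_def coeff_1)
    finally show ?thesis .
  qed
  have "norm x \<le> 1" if "x \<in># proots (?f p)" for x
  proof -
    have "?f p \<noteq> 0" using lead by (auto simp: map_poly_eq_0_iff)
    then have "poly (?f p) x = 0" using that by simp
    then have "poly (monom 1 N - 1) x = 0" by (simp flip: eq)
    then have "x ^ N = 1" by (simp add: poly_monom)
    then have "norm x ^ N = 1" by (simp flip: norm_power)
    then show ?thesis using \<open>N > 0\<close> by (auto dest: power_eq_1_iff)
  qed
  then have "norm (coeff (\<Prod>x\<in>#proots (?f p). [:- x, 1:]) k) \<le> 2 ^ size (proots (?f p))"
    by (rule norm_coeff_prod_linear_le)
  moreover have deg: "degree (?f p) = degree p" by (rule degree_map_poly) simp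
  moreover have "norm (lead_coeff (?f p)) = 1"
    using lead by (simp add: deg coeff_map_poly)
  moreover have "norm (coeff (?f p) k) = norm (lead_coeff (?f p)) * norm (coeff (\<Prod>x\<in>#proots (?f p). [:- x, 1:]) k)"
    by (simp flip: coeff_smult norm_mult add: complex_poly_decompose_multiset)
  ultimately have "norm (coeff (?f p) k) \<le> 2 ^ degree p"
    by (simp add: size_proots_complex)
  then have "real_of_int \<bar>coeff p k\<bar> \<le> real_of_int (2 ^ degree p)"
    by (simp add: coeff_map_poly)
  then show ?thesis by (simp only: of_int_le_iff)
qed

text \<open>A form of Gauss's lemma: contents multiply, so if \<open>p\<close> has content 1, the
  constant \<open>c\<close> divides the content of the cofactor and can be cancelled.\<close>

lemma dvd_of_dvd_smult_primitive:
  fixes p f :: "int poly"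
  assumes "c \<noteq> 0" and "content p = 1" and "p dvd smult c f"
  shows "p dvd f"
proof -
  obtain q where q: "smult c f = p * q" using assms(3) by blast
  have "content q = \<bar>c\<bar> * content f"
    using arg_cong[OF q, of content] assms by (simp add: content_mult)
  then have "[:c:] dvd q"
    by (simp add: const_poly_dvd_iff_dvd_content)
  then obtain q' where "q = smult c q'"
  proof -
    obtain k where "q = [:c:] * k" using \<open>[:c:] dvd q\<close> ..
    then have "q = Polynomial.smult c k" by simp
    then show ?thesis using that by blast
  qed
  then have "smult c f = smult c (p * q')" using q by simp
  then have "smult c (f - p * q') = 0" by (simp add: smult_diff_right)
  then have "f = p * q'" using \<open>c \<noteq> 0\<close> by simp
  then show ?thesis by simp
qed


section \<open>Finiteness of the torsion of a number field\<close>

text \<open>Links two worlds: integer polynomials as a type, and a field given as a record. The map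
  \<open>\<iota>\<close> is an injective ring homomorphism from the integers, so the field has
  characteristic 0.\<close>

locale poly_eval = field K for K (structure) +
  fixes \<iota> :: "int \<Rightarrow> 'a" and x :: 'a
  assumes \<iota>_closed [simp]: "\<iota> a \<in> carrier K"
    and \<iota>_add: "\<iota> (a + b) = \<iota> a \<oplus> \<iota> b"
    and \<iota>_mult: "\<iota> (a * b) = \<iota> a \<otimes> \<iota> b"
    and \<iota>_one [simp]: "\<iota> 1 = \<one>"
    and \<iota>_eq_0: "\<iota> a = \<zero> \<longleftrightarrow> a = 0"
    and x_closed [simp]: "x \<in> carrier K"
begin

definition ev :: "int poly \<Rightarrow> 'a"
  where "ev p = fold_coeffs (\<lambda>a b. \<iota> a \<oplus> x \<otimes> b) p \<zero>"

lemma ev_0 [simp]: "ev 0 = \<zero>"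
  by (simp add: ev_def)

lemma \<iota>_zero [simp]: "\<iota> 0 = \<zero>"
  by (simp add: \<iota>_eq_0)

lemma ev_pCons [simp]: "ev (pCons a p) = \<iota> a \<oplus> x \<otimes> ev p"
  by (cases "a = 0"; cases "p = 0") (simp_all add: ev_def)

lemma ev_closed [simp]: "ev p \<in> carrier K"
  by (induction p) auto

lemma ev_add: "ev (p + q) = ev p \<oplus> ev q"
proof (induction p arbitrary: q)
  case (pCons a p)
  then show ?case
    by (cases q) (auto simp: \<iota>_add r_distr a_ac)
qed auto

lemma ev_smult: "ev (Polynomial.smult c p) = \<iota> c \<otimes> ev p"
  by (induction p) (auto simp: \<iota>_mult r_distr m_ac)

lemma ev_mult: "ev (p * q) = ev p \<otimes> ev q"
  by (induction p) (auto simp: ev_add ev_smult l_distr m_assoc)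

lemma ev_1 [simp]: "ev 1 = \<one>"
  by (simp add: one_pCons)

lemma ev_monom: "ev (Polynomial.monom 1 n) = x [^] n"
proof (induction n)
  case (Suc n)
  then show ?case by (simp add: monom_Suc m_comm)
qed (simp add: monom_0)

lemma ev_unity_poly: "ev (unity_poly n) = \<zero> \<longleftrightarrow> x [^] n = \<one>"
proof -
  have "x [^] n = ev (unity_poly n) \<oplus> \<one>"
    using ev_add[of "unity_poly n" 1] by (simp add: unity_poly_def ev_monom)
  then show ?thesis
    by (metis add.r_cancel_one ev_closed l_zero one_closed)
qed

text \<open>Translates a linear dependence among powers of \<open>x\<close> into a polynomial
  equation for \<open>x\<close>. The application has \<open>k = 0\<close>; a general
  \<open>k\<close> is there for the induction.\<close>

lemma combine_powers:
  "combine (map \<iota> zs) (map (\<lambda>i. x [^] i) [k..<k + length zs]) = x [^] k \<otimes> ev (Poly zs)"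
proof (induction zs arbitrary: k)
  case (Cons z zs)
  have "[k..<k + length (z # zs)] = k # [Suc k..<Suc k + length zs]"
    by (simp add: upt_rec)
  then show ?case
    using Cons[of "Suc k"] by (simp add: r_distr m_ac)
qed simp

text \<open>Take the primitive part of a nonzero polynomial of least degree vanishing at
  \<open>x\<close>. Pseudo-division of X ^ N - 1 by it leaves a remainder that vanishes at
  \<open>x\<close> and has smaller degree, hence is 0; primitivity then removes the constant
  multiplier. The comparison with \<open>p0\<close> keeps the degree under a bound that is
  independent of \<open>N\<close>.\<close>

lemma minimal_poly_dvd_unity_poly:
  assumes N: "x [^] N = \<one>" and "p0 \<noteq> 0" and "ev p0 = \<zero>"
  obtains p where "p dvd unity_poly N" "Polynomial.degree p \<le> Polynomial.degree p0" "ev p = \<zero>"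
proof -
  obtain p1 where p1: "p1 \<noteq> 0 \<and> ev p1 = \<zero>"
    and min: "\<And>q. q \<noteq> 0 \<and> ev q = \<zero> \<Longrightarrow> Polynomial.degree p1 \<le> Polynomial.degree q"
    using ex_has_least_nat[of "\<lambda>p. p \<noteq> 0 \<and> ev p = \<zero>" p0 Polynomial.degree] assms by blast
  define p where "p = primitive_part p1"
  have eq: "Polynomial.smult (content p1) p = p1" by (simp add: p_def)
  have p: "p \<noteq> 0" "content p = 1" "Polynomial.degree p = Polynomial.degree p1"
    using p1 by (simp_all add: p_def)
  have "\<iota> (content p1) \<otimes> ev p = \<zero>" using p1 eq ev_smult by metis
  then have ev: "ev p = \<zero>" using p1 by (simp add: integral_iff \<iota>_eq_0)
  obtain a q where a: "a \<noteq> 0" and aq: "Polynomial.smult a (unity_poly N) = p * q + pseudo_mod (unity_poly N) p"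
    and r: "pseudo_mod (unity_poly N) p = 0 \<or> Polynomial.degree (pseudo_mod (unity_poly N) p) < Polynomial.degree p"
    using pseudo_mod[OF p(1), of "unity_poly N"] by blast
  have "ev (unity_poly N) = \<zero>" using N by (simp add: ev_unity_poly)
  then have "ev (pseudo_mod (unity_poly N) p) = \<zero>"
    using arg_cong[OF aq, of ev] ev by (simp add: ev_add ev_mult ev_smult)
  then have "pseudo_mod (unity_poly N) p = 0"
    using r min p(3) by (metis linorder_not_le)
  then have "p dvd Polynomial.smult a (unity_poly N)" using aq by simp
  then have "p dvd unity_poly N" by (rule dvd_of_dvd_smult_primitive[OF a p(2)])
  moreover have "Polynomial.degree p \<le> Polynomial.degree p0" using min assms p(3) by auto
  ultimately show ?thesis using that ev by blast
qed

end

lemma common_denominator: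
  fixes qs :: "rat list"
  obtains c :: int and zs where "c \<noteq> 0" "map (\<lambda>q. of_int c * q) qs = map of_int zs"
proof (induction qs arbitrary: thesis)
  case Nil
  show ?case by (rule Nil[of 1 "[]"]) auto
next
  case (Cons q qs)
  obtain c zs where c: "c \<noteq> 0" "map (\<lambda>q. of_int c * q) qs = map of_int zs"
    using Cons.IH by blast
  obtain a b :: int where "q = Rat.Fract a b" "b > 0" by (cases q) auto
  then have q: "q = of_int a / of_int b" "b \<noteq> 0" by (simp_all add: Fract_of_int_quotient)
  have "map (\<lambda>q. of_int (c * b) * q) qs = map (\<lambda>q. of_int b * (of_int c * q)) qs"
    by (simp add: mult_ac)
  also have "\<dots> = map ((*) (of_int b)) (map (\<lambda>q. of_int c * q) qs)" by simp
  also have "\<dots> = map of_int (map ((*) b) zs)" unfolding c by simp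
  finally show ?case
    using Cons.prems[of "c * b" "(c * a) # map ((*) b) zs"] c q by (simp add: mult_ac)
qed

lemma (in field) card_roots_of_unity_le:
  assumes "n > 0"
  shows "finite {x \<in> carrier R. x [^] n = \<one>}" "card {x \<in> carrier R. x [^] n = \<one>} \<le> n"
proof -
  \<comment> \<open>The coefficient list of X ^ n - 1, highest degree first.\<close>
  define p where "p = \<one> # replicate (n - 1) \<zero> @ [\<ominus> \<one>]"
  have p: "p \<in> carrier (poly_ring R)"
    unfolding univ_poly_carrier[symmetric] polynomial_def p_def by auto
  have "eval p x = x [^] n \<oplus> \<ominus> \<one>" if "x \<in> carrier R" for x
    using that eval_replicate[of "[\<ominus> \<one>]" x "n - 1"] assms by (simp add: p_def)
  then have "is_root p x \<longleftrightarrow> x \<in> carrier R \<and> x [^] n = \<one>" for x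
    by (auto simp: is_root_def p_def r_neg minus_equality)
       (metis minus_equality minus_minus nat_pow_closed one_closed add.inv_closed add.m_comm)
  then have eq: "{x \<in> carrier R. x [^] n = \<one>} = set_mset (roots p)"
    using roots_mem_iff_is_root[OF p] by auto
  show "finite {x \<in> carrier R. x [^] n = \<one>}"
    unfolding eq by simp
  have "card (set_mset (roots p)) \<le> size (roots p)"
    by (metis mset_set_set_mset_msubset size_mset_mono size_mset_set)
  also have "\<dots> \<le> n"
    using size_roots_le_degree[OF p] assms by (simp add: p_def)
  finally show "card {x \<in> carrier R. x [^] n = \<one>} \<le> n"
    unfolding eq .
qed

text \<open>If \<open>n\<close> is the degree of the field, the \<open>n + 1\<close> powers 1, ...,
  x ^ n are linearly dependent over the rationals. Clearing denominators makes the coefficients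
  integers. The bound \<open>D\<close> is this degree, the same for all \<open>x\<close>.\<close>

lemma number_field_poly_eval:
  fixes K :: "('a, 'b) ring_scheme"
  assumes "number_field K"
  obtains \<iota> D where "\<And>x. x \<in> carrier K \<Longrightarrow> poly_eval K \<iota> x"
    and "\<And>x. x \<in> carrier K \<Longrightarrow> \<exists>p. p \<noteq> 0 \<and> Polynomial.degree p \<le> D \<and> poly_eval.ev K \<iota> x p = \<zero>\<^bsub>K\<^esub>"
proof -
  let ?Q = "ring_of_type_algebra :: rat ring"
  interpret K: field K using assms by (simp add: number_field_def)
  interpret Q: field ?Q by (rule field_from_type_algebra)
  obtain \<phi> where \<phi>: "\<phi> \<in> ring_hom ?Q K" and fd: "K.finite_dimension (range \<phi>) (carrier K)"
    using assms by (auto simp: number_field_def)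
  interpret h: ring_hom_ring ?Q K \<phi>
    by (intro ring_hom_ringI2 \<phi> Q.ring_axioms K.ring_axioms)
  have Q_simps: "carrier ?Q = UNIV" "\<one>\<^bsub>?Q\<^esub> = 1" "\<zero>\<^bsub>?Q\<^esub> = 0"
    "a \<oplus>\<^bsub>?Q\<^esub> b = a + b" "a \<otimes>\<^bsub>?Q\<^esub> b = a * b" for a b
    by (simp_all add: ring_of_type_algebra_def)
  have sub: "subfield (range \<phi>) K" and inj: "inj \<phi>"
    using h.img_is_subfield[of UNIV] Q.carrier_is_subfield K.one_not_zero by (simp_all add: Q_simps)
  obtain n where n: "K.dimension n (range \<phi>) (carrier K)"
    using fd by (auto simp: K.finite_dimension_def)
  define \<iota> where "\<iota> a = \<phi> (of_int a)" for a
  have \<phi>0: "\<phi> q = \<zero>\<^bsub>K\<^esub> \<longleftrightarrow> q = 0" for q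
    using h.hom_zero injD[OF inj, of q 0] by (auto simp: Q_simps)
  have ev: "poly_eval K \<iota> x" if "x \<in> carrier K" for x
  proof unfold_locales
    show "\<iota> a \<in> carrier K" for a
      using h.hom_closed by (simp add: \<iota>_def Q_simps)
    show "\<iota> (a + b) = \<iota> a \<oplus>\<^bsub>K\<^esub> \<iota> b" "\<iota> (a * b) = \<iota> a \<otimes>\<^bsub>K\<^esub> \<iota> b" for a b
      using h.hom_add[of "of_int a" "of_int b"] h.hom_mult[of "of_int a" "of_int b"]
      by (simp_all add: \<iota>_def Q_simps)
    show "\<iota> 1 = \<one>\<^bsub>K\<^esub>" using h.hom_one by (simp add: \<iota>_def Q_simps)
    show "\<iota> a = \<zero>\<^bsub>K\<^esub> \<longleftrightarrow> a = 0" for a by (simp add: \<iota>_def \<phi>0)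
    show "x \<in> carrier K" by (rule that)
  qed
  have "\<exists>p. p \<noteq> 0 \<and> Polynomial.degree p \<le> n \<and> poly_eval.ev K \<iota> x p = \<zero>\<^bsub>K\<^esub>"
    if x: "x \<in> carrier K" for x
  proof -
    interpret poly_eval K \<iota> x by (rule ev[OF x])
    define Us where "Us = map (\<lambda>i. x [^]\<^bsub>K\<^esub> i) [0..<Suc n]"
    have Us: "set Us \<subseteq> carrier K" and len: "length Us = Suc n"
      using x by (auto simp: Us_def)
    have "\<not> K.independent (range \<phi>) Us"
      using K.independent_length_le_dimension[OF sub n _ Us] len by auto
    then obtain Ks where Ks: "length Ks = length Us" "K.combine Ks Us = \<zero>\<^bsub>K\<^esub>"
      "set Ks \<subseteq> range \<phi>" "set Ks \<noteq> {\<zero>\<^bsub>K\<^esub>}"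
      using K.dependent_imp_non_trivial_combine[OF sub Us] by blast
    obtain qs where qs: "Ks = map \<phi> qs"
      using Ks(3) by (metis ex_map_conv subset_code(1) imageE)
    obtain c zs where c: "c \<noteq> 0" and zs: "map (\<lambda>q. of_int c * q) qs = map of_int zs"
      by (rule common_denominator)
    have Ks_zs: "map (\<lambda>k. \<iota> c \<otimes>\<^bsub>K\<^esub> k) Ks = map \<iota> zs"
    proof -
      have "map (\<lambda>k. \<iota> c \<otimes>\<^bsub>K\<^esub> k) Ks = map \<phi> (map (\<lambda>q. of_int c * q) qs)"
        using h.hom_mult by (simp add: qs \<iota>_def Q_simps)
      then show ?thesis by (simp add: zs \<iota>_def)
    qed
    have lz: "length zs = Suc n"
      using arg_cong[OF Ks_zs, of length] Ks(1) len by simp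
    have "set Ks \<subseteq> carrier K" using Ks(3) h.hom_closed by (auto simp: Q_simps)
    then have "K.combine (map \<iota> zs) Us = \<zero>\<^bsub>K\<^esub>"
      using K.combine_r_distr[OF _ Us, of Ks "\<iota> c"] Ks(2) Ks_zs by simp
    then have "ev (Poly zs) = \<zero>\<^bsub>K\<^esub>"
      using combine_powers[of zs 0] x by (simp add: Us_def lz del: upt_Suc)
    moreover have "Poly zs \<noteq> 0"
    proof
      assume "Poly zs = 0"
      then obtain m where "zs = replicate m 0"
        by (auto simp: Poly_eq_0)
      then have "set (map \<iota> zs) \<subseteq> {\<zero>\<^bsub>K\<^esub>}"
        by auto
      then have "(\<lambda>k. \<iota> c \<otimes>\<^bsub>K\<^esub> k) ` set Ks \<subseteq> {\<zero>\<^bsub>K\<^esub>}"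
        by (simp flip: Ks_zs)
      then have "\<forall>k\<in>set Ks. \<iota> c \<otimes>\<^bsub>K\<^esub> k = \<zero>\<^bsub>K\<^esub>"
        by blast
      then have "\<forall>k\<in>set Ks. k = \<zero>\<^bsub>K\<^esub>"
        using \<open>set Ks \<subseteq> carrier K\<close> c by (auto simp: \<iota>_eq_0 K.integral_iff subset_iff)
      \<comment> \<open>That \<open>set Ks\<close> differs from the singleton of zero would also
        hold for an empty list, so this case has to be excluded.\<close>
      moreover have "Ks \<noteq> []" using Ks(1) len by auto
      ultimately show False using Ks(4) by (cases Ks) auto
    qed
    moreover have "Polynomial.degree (Poly zs) \<le> n"
      using lz by (intro degree_le) (auto simp: nth_default_def)
    ultimately show ?thesis by blast
  qed
  then show ?thesis using that ev by blast
qed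

text \<open>Each root of unity is a zero of some member of \<open>S\<close>, by minimality arguments
  at that element, and \<open>S\<close> is finite by the coefficient bound. Choosing for each
  \<open>p\<close> in \<open>S\<close> one exponent \<open>N p\<close> with \<open>p\<close>
  dividing X ^ (N p) - 1 puts all zeros of \<open>p\<close> among the finitely many
  \<open>N p\<close>-th roots of unity.\<close>

lemma number_field_finite_torsion:
  fixes K :: "('a, 'b) ring_scheme"
  assumes "number_field K"
  shows "finite (torsion_set (mult_of K))"
proof -
  interpret K: field K using assms by (simp add: number_field_def)
  obtain \<iota> D where ev: "\<And>x. x \<in> carrier K \<Longrightarrow> poly_eval K \<iota> x"
    and D: "\<And>x. x \<in> carrier K \<Longrightarrow>
      \<exists>p. p \<noteq> 0 \<and> Polynomial.degree p \<le> D \<and> poly_eval.ev K \<iota> x p = \<zero>\<^bsub>K\<^esub>"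
    using number_field_poly_eval[OF assms] by metis
  define S where "S = {p. Polynomial.degree p \<le> D \<and> (\<exists>N>0. p dvd unity_poly N)}"
  have "S \<subseteq> {p. Polynomial.degree p \<le> D \<and> (\<forall>k. \<bar>poly.coeff p k\<bar> \<le> 2 ^ D)}"
  proof
    fix p assume p: "p \<in> S"
    then obtain N where "N > 0" "p dvd unity_poly N" by (auto simp: S_def)
    then have "\<bar>poly.coeff p k\<bar> \<le> 2 ^ Polynomial.degree p" for k
      by (simp add: coeff_bound_of_dvd_unity_poly)
    moreover have "(2::int) ^ Polynomial.degree p \<le> 2 ^ D"
      using p by (simp add: S_def)
    ultimately show "p \<in> {p. Polynomial.degree p \<le> D \<and> (\<forall>k. \<bar>poly.coeff p k\<bar> \<le> 2 ^ D)}"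
      using p order_trans unfolding S_def by blast
  qed
  then have finS: "finite S"
    using finite_bounded_int_polys finite_subset by blast
  obtain N where N: "\<And>p. p \<in> S \<Longrightarrow> N p > 0 \<and> p dvd unity_poly (N p)"
    using bchoice[of S "\<lambda>p N. N > 0 \<and> p dvd unity_poly N"] by (auto simp: S_def)
  have "torsion_set (mult_of K) \<subseteq> (\<Union>p\<in>S. {x \<in> carrier K. x [^]\<^bsub>K\<^esub> N p = \<one>\<^bsub>K\<^esub>})"
  proof
    fix x assume "x \<in> torsion_set (mult_of K)"
    then obtain n :: nat where x: "x \<in> carrier K" and n: "n > 0" "x [^]\<^bsub>K\<^esub> n = \<one>\<^bsub>K\<^esub>"
      by (auto simp: torsion_set_def Multiplicative_Group.nat_pow_mult_of)
    interpret poly_eval K \<iota> x by (rule ev[OF x])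
    obtain p0 where p0: "p0 \<noteq> 0" "Polynomial.degree p0 \<le> D" "ev p0 = \<zero>\<^bsub>K\<^esub>"
      using D[OF x] by blast
    obtain p where p: "p dvd unity_poly n" "Polynomial.degree p \<le> Polynomial.degree p0" "ev p = \<zero>\<^bsub>K\<^esub>"
      using minimal_poly_dvd_unity_poly[OF n(2) p0(1,3)] by blast
    then have "p \<in> S" using n p0 by (auto simp: S_def)
    then obtain q where "unity_poly (N p) = p * q" using N by blast
    then have "ev (unity_poly (N p)) = \<zero>\<^bsub>K\<^esub>" by (simp add: ev_mult p(3))
    then show "x \<in> (\<Union>p\<in>S. {x \<in> carrier K. x [^]\<^bsub>K\<^esub> N p = \<one>\<^bsub>K\<^esub>})"
      using \<open>p \<in> S\<close> x by (auto simp: ev_unity_poly)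
  qed
  then show ?thesis
    by (rule finite_subset) (use finS N K.card_roots_of_unity_le(1) in blast)
qed


section \<open>Products of powers in commutative groups\<close>

definition power_product :: "('a, 'b) monoid_scheme \<Rightarrow> 'i set \<Rightarrow> ('i \<Rightarrow> 'a) \<Rightarrow> ('i \<Rightarrow> int) \<Rightarrow> 'a"
  where "power_product A I f x = (\<Otimes>\<^bsub>A\<^esub>i\<in>I. f i [^]\<^bsub>A\<^esub> x i)"

text \<open>Stands in for the group of exponent vectors. Functions on the whole index type avoid any
  restriction to the index set \<open>I\<close>: values outside \<open>I\<close> do not affect
  \<open>power_product\<close>, so they only enlarge the kernels.\<close>

definition int_functions :: "('i \<Rightarrow> int) monoid"
  where "int_functions = \<lparr>carrier = UNIV, monoid.mult = (\<lambda>x y i. x i + y i), one = (\<lambda>_. 0)\<rparr>"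

lemma int_functions_simps [simp]:
  "carrier int_functions = UNIV"
  "x \<otimes>\<^bsub>int_functions\<^esub> y = (\<lambda>i. x i + y i)"
  "\<one>\<^bsub>int_functions\<^esub> = (\<lambda>_. 0)"
  by (simp_all add: int_functions_def)

lemma group_int_functions [simp]: "group int_functions"
proof (rule groupI)
  show "\<exists>y\<in>carrier int_functions. y \<otimes>\<^bsub>int_functions\<^esub> x = \<one>\<^bsub>int_functions\<^esub>" for x :: "'i \<Rightarrow> int"
    by (rule bexI[of _ "\<lambda>i. - x i"]) auto
qed auto

context comm_group
begin

lemma power_product_closed [simp]:
  "f \<in> I \<rightarrow> carrier G \<Longrightarrow> power_product G I f x \<in> carrier G"
  unfolding power_product_def by (rule finprod_closed) auto

lemma power_product_add:
  assumes "f \<in> I \<rightarrow> carrier G"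
  shows "power_product G I f (\<lambda>i. x i + y i) = power_product G I f x \<otimes> power_product G I f y"
proof -
  have "power_product G I f (\<lambda>i. x i + y i) = (\<Otimes>i\<in>I. f i [^] x i \<otimes> f i [^] y i)"
    unfolding power_product_def
    by (rule finprod_cong') (use assms in \<open>auto simp: Pi_iff int_pow_mult\<close>)
  also have "\<dots> = power_product G I f x \<otimes> power_product G I f y"
    unfolding power_product_def by (rule finprod_multf) (use assms in auto)
  finally show ?thesis .
qed

lemma power_product_hom:
  "f \<in> I \<rightarrow> carrier G \<Longrightarrow> power_product G I f \<in> hom int_functions G"
  by (auto simp: hom_def power_product_add)

lemma power_product_mult_exponents:
  assumes "f \<in> I \<rightarrow> carrier G"
  shows "power_product G I f (\<lambda>i. c i * x i) = power_product G I (\<lambda>i. f i [^] c i) x"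
  unfolding power_product_def
  by (rule finprod_cong') (use assms in \<open>auto simp: Pi_iff int_pow_pow\<close>)

lemma power_product_mult:
  assumes "f \<in> I \<rightarrow> carrier G" "g \<in> I \<rightarrow> carrier G"
  shows "power_product G I (\<lambda>i. f i \<otimes> g i) x = power_product G I f x \<otimes> power_product G I g x"
proof -
  have "power_product G I (\<lambda>i. f i \<otimes> g i) x = (\<Otimes>i\<in>I. f i [^] x i \<otimes> g i [^] x i)"
    unfolding power_product_def
    by (rule finprod_cong') (use assms in \<open>auto simp: Pi_iff int_pow_distrib\<close>)
  also have "\<dots> = power_product G I f x \<otimes> power_product G I g x"
    unfolding power_product_def by (rule finprod_multf) (use assms in auto)
  finally show ?thesis .
qed

lemma power_product_pow:
  assumes "f \<in> I \<rightarrow> carrier G"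
  shows "power_product G I f x [^] (n :: int) = power_product G I f (\<lambda>i. n * x i)"
proof -
  interpret h: group_hom G G "\<lambda>a. a [^] n"
    by unfold_locales (auto simp: hom_def int_pow_distrib)
  show ?thesis
    using assms unfolding power_product_def
    by (induction I rule: infinite_finite_induct)
       (simp_all add: Pi_iff int_pow_distrib int_pow_pow mult.commute)
qed

lemma power_product_cong:
  assumes "\<And>i. i \<in> I \<Longrightarrow> f i = g i" "\<And>i. i \<in> I \<Longrightarrow> x i = y i" "g \<in> I \<rightarrow> carrier G"
  shows "power_product G I f x = power_product G I g y"
  unfolding power_product_def by (rule finprod_cong') (use assms in auto)

lemma power_product_in_generate:
  assumes "f \<in> I \<rightarrow> carrier G"
  shows "power_product G I f x \<in> generate G (f ` I)"
proof -
  have sub: "subgroup (generate G (f ` I)) G"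
    using assms by (intro generate_is_subgroup) auto
  have "power_product G J f x \<in> generate G (f ` I)" if "J \<subseteq> I" for J
    using that
  proof (induction J rule: infinite_finite_induct)
    case (insert j J)
    have "f j [^] x j \<in> generate G (f ` I)"
      using subgroup_int_pow_closed[OF sub] insert.prems by (auto intro: generate.incl)
    then have "f j [^] x j \<otimes> power_product G J f x \<in> generate G (f ` I)"
      using insert by (intro subgroup.m_closed[OF sub]) auto
    moreover have "power_product G (insert j J) f x = f j [^] x j \<otimes> power_product G J f x"
      unfolding power_product_def using insert assms by (intro finprod_insert) auto
    ultimately show ?case by simp
  qed (auto simp: power_product_def generate.one)
  then show ?thesis by blast
qed

lemma power_product_single:
  assumes "finite I" "f \<in> I \<rightarrow> carrier G" "i \<in> I"
  shows "power_product G I f (\<lambda>j. if j = i then 1 else 0) = f i"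
proof -
  have "power_product G I f (\<lambda>j. if j = i then 1 else 0) = (\<Otimes>j\<in>I. if i = j then f j else \<one>)"
    unfolding power_product_def
    by (rule finprod_cong') (use assms in \<open>auto simp: Pi_iff\<close>)
  also have "\<dots> = f i"
    using assms by (intro finprod_singleton) auto
  finally show ?thesis .
qed

lemma generate_eq_range_power_product:
  assumes "finite I" "f \<in> I \<rightarrow> carrier G"
  shows "generate G (f ` I) = range (power_product G I f)"
proof
  interpret h: group_hom int_functions G "power_product G I f"
    by (intro group_hom.intro group_hom_axioms.intro power_product_hom assms group_int_functions
        is_group)
  have "f ` I \<subseteq> range (power_product G I f)"
    using power_product_single[OF assms] by (auto simp: image_iff) metis
  moreover have "subgroup (range (power_product G I f)) G"
    using h.img_is_subgroup by simp
  ultimately show "generate G (f ` I) \<subseteq> range (power_product G I f)"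
    by (rule generate_subgroup_incl)
qed (use power_product_in_generate assms in auto)

lemma subgroup_imp_comm_group:
  assumes "subgroup H G"
  shows "comm_group (G\<lparr>carrier := H\<rparr>)"
proof (rule group.group_comm_groupI[OF subgroup_imp_group[OF assms]])
  show "x \<otimes>\<^bsub>G\<lparr>carrier := H\<rparr>\<^esub> y = y \<otimes>\<^bsub>G\<lparr>carrier := H\<rparr>\<^esub> x"
    if "x \<in> carrier (G\<lparr>carrier := H\<rparr>)" "y \<in> carrier (G\<lparr>carrier := H\<rparr>)" for x y
    using m_comm[of x y] subgroup.subset[OF assms] that by auto
qed

lemma power_product_subgroup:
  assumes H: "subgroup H G" and f: "f \<in> I \<rightarrow> H"
  shows "power_product (G\<lparr>carrier := H\<rparr>) I f x = power_product G I f x"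
proof -
  let ?H = "G\<lparr>carrier := H\<rparr>"
  interpret H: comm_group ?H by (rule subgroup_imp_comm_group[OF H])
  have closed: "f j [^]\<^bsub>?H\<^esub> x j \<in> carrier ?H" "f j [^] x j \<in> carrier G" if "j \<in> I" for j
    using f that subgroup.subset[OF H] H.int_pow_closed[of "f j" "x j"] by (auto simp del: H.int_pow_closed)
  have "power_product ?H J f x = power_product G J f x" if "J \<subseteq> I" for J
    using that
  proof (induction J rule: infinite_finite_induct)
    case (insert j J)
    have "power_product ?H (insert j J) f x = f j [^]\<^bsub>?H\<^esub> x j \<otimes>\<^bsub>?H\<^esub> power_product ?H J f x"
      unfolding power_product_def
      using insert closed(1) by (intro H.finprod_insert Pi_I) blast+
    moreover have "power_product G (insert j J) f x = f j [^] x j \<otimes> power_product G J f x"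
      unfolding power_product_def
      using insert closed(2) by (intro finprod_insert Pi_I) blast+
    moreover have "f j [^] x j = f j [^]\<^bsub>?H\<^esub> x j"
      using insert f by (intro int_pow_consistent[OF H]) auto
    ultimately show ?case using insert by simp
  qed (simp_all add: power_product_def)
  then show ?thesis by blast
qed

lemma subgroup_powers: "subgroup (powers G k) G"
proof -
  interpret h: group_hom G G "\<lambda>a. a [^] k"
    by unfold_locales (auto simp: hom_def nat_pow_distrib)
  show ?thesis
    unfolding powers_def using h.img_is_subgroup .
qed

lemma subgroup_torsion_set: "subgroup (torsion_set G) G"
proof (rule subgroupI)
  show "torsion_set G \<subseteq> carrier G" by (auto simp: torsion_set_def)
  have "\<one> \<in> torsion_set G"
    unfolding torsion_set_def using zero_less_one[where 'a = nat] by force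
  then show "torsion_set G \<noteq> {}" by blast
  show "inv a \<in> torsion_set G" if "a \<in> torsion_set G" for a
    using that by (auto simp: torsion_set_def nat_pow_inv)
  show "a \<otimes> b \<in> torsion_set G" if tors: "a \<in> torsion_set G" "b \<in> torsion_set G" for a b
  proof -
    obtain m n :: nat where mn: "m > 0" "n > 0" "a [^] m = \<one>" "b [^] n = \<one>"
      and ab: "a \<in> carrier G" "b \<in> carrier G"
      using tors by (auto simp: torsion_set_def)
    have "a [^] (m * n) = \<one>"
      using nat_pow_pow[OF ab(1), of m n] mn(3) by simp
    moreover have "b [^] (m * n) = \<one>"
      using nat_pow_pow[OF ab(2), of n m] mn(4) by (simp add: mult.commute)
    ultimately have "(a \<otimes> b) [^] (m * n) = \<one>"
      using ab by (simp add: nat_pow_distrib)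
    then show ?thesis
      unfolding torsion_set_def using ab mn(1,2)
      by (intro CollectI conjI m_closed exI[of _ "m * n"]) simp_all
  qed
qed

end

text \<open>By the first isomorphism theorem both targets are isomorphic to the quotient of
  \<open>A\<close> by the common kernel. This spares the construction of a map between two
  quotients.\<close>

lemma iso_of_surj_homs_same_kernel:
  assumes "group A" "group H" "group H'" and "f \<in> hom A H" "g \<in> hom A H'"
    and "f ` carrier A = carrier H" "g ` carrier A = carrier H'"
    and "kernel A H f = kernel A H' g"
  shows "H \<cong> H'"
proof -
  interpret f: group_hom A H f using assms by (simp add: group_hom_def group_hom_axioms_def)
  interpret g: group_hom A H' g using assms by (simp add: group_hom_def group_hom_axioms_def)
  have "A Mod kernel A H f \<cong> H" by (rule f.FactGroup_iso[OF assms(6)])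
  then have "H \<cong> A Mod kernel A H f"
    by (rule group.iso_sym[OF normal.factorgroup_is_group[OF f.normal_kernel]])
  also have "\<dots> \<cong> H'" using g.FactGroup_iso[OF assms(7)] assms(8) by simp
  finally show ?thesis .
qed

text \<open>Elements of \<open>sum_group\<close> are extensional functions on the index set, hence
  the restriction in \<open>g\<close>; over a finite index set the condition of finite support is
  vacuous.\<close>

lemma sum_group_integer_mod_group_proj:
  fixes N :: "'i \<Rightarrow> nat"
  assumes "finite I" "\<And>i. i \<in> I \<Longrightarrow> N i > 0"
  defines "S \<equiv> sum_group I (\<lambda>i. integer_mod_group (N i))"
    and "g \<equiv> (\<lambda>x. \<lambda>i\<in>I. x i mod int (N i))"
  shows "g \<in> hom int_functions S" "range g = carrier S"
    and "kernel int_functions S g = {x. \<forall>i\<in>I. int (N i) dvd x i}"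
proof -
  have car: "carrier S = (\<Pi>\<^sub>E i\<in>I. {0..<int (N i)})"
  proof -
    have "carrier S = (\<Pi>\<^sub>E i\<in>I. carrier (integer_mod_group (N i)))"
      using assms(1) by (simp add: S_def carrier_sum_group)
    also have "\<dots> = (\<Pi>\<^sub>E i\<in>I. {0..<int (N i)})"
      by (rule PiE_cong) (use assms(2) in \<open>auto simp: carrier_integer_mod_group\<close>)
    finally show ?thesis .
  qed
  show "g \<in> hom int_functions S"
  proof (rule homI)
    show "g x \<in> carrier S" for x by (auto simp: car g_def assms(2))
    show "g (x \<otimes>\<^bsub>int_functions\<^esub> y) = g x \<otimes>\<^bsub>S\<^esub> g y" for x y
      by (auto simp: g_def S_def mod_simps restrict_def fun_eq_iff)
  qed
  show "range g = carrier S"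
  proof
    show "range g \<subseteq> carrier S" by (auto simp: car g_def assms(2))
    show "carrier S \<subseteq> range g"
    proof
      fix x assume "x \<in> carrier S"
      then have "x \<in> extensional I" "\<forall>i\<in>I. 0 \<le> x i \<and> x i < int (N i)"
        by (auto simp: car PiE_iff)
      then have "g x = x"
        by (intro extensionalityI[of _ I]) (auto simp: g_def)
      then show "x \<in> range g" by (metis rangeI)
    qed
  qed
  show "kernel int_functions S g = {x. \<forall>i\<in>I. int (N i) dvd x i}"
    by (auto simp: kernel_def g_def S_def fun_eq_iff restrict_def dvd_eq_mod_eq_0)
qed


section \<open>Roots of unity of prime power order\<close>

text \<open>Truncated subtraction merges two cases: for \<open>a \<le> b\<close> both sides are
  true. All exponents of orders below are kept in this truncated form.\<close>

lemma prime_power_dvd_mult_iff: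
  fixes l :: nat
  assumes "l > 0"
  shows "l ^ a dvd l ^ b * k \<longleftrightarrow> l ^ (a - b) dvd k"
proof (cases "b \<le> a")
  case True
  then have "l ^ a = l ^ b * l ^ (a - b)"
    by (simp flip: power_add)
  then show ?thesis using assms by simp
next
  case False
  then show ?thesis by (simp add: le_imp_power_dvd)
qed

lemma int_power_dvd_mult_iff:
  fixes l :: nat
  assumes "l > 0"
  shows "int l ^ a dvd int l ^ b * k \<longleftrightarrow> int l ^ (a - b) dvd k"
proof (cases "b \<le> a")
  case True
  then have "int l ^ a = int l ^ b * int l ^ (a - b)"
    by (simp flip: power_add)
  then show ?thesis using assms by simp
next
  case False
  then show ?thesis by (simp add: le_imp_power_dvd)
qed

lemma (in group) ord_pow_prime_power:
  assumes "x \<in> carrier G" "ord x = l ^ h" "l > 0"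
  shows "ord (x [^] (l ^ d)) = l ^ (h - d)"
  using assms by (simp add: ord_unique nat_pow_pow pow_eq_id prime_power_dvd_mult_iff)

context field
begin

lemma field_mult_comm_group: "comm_group (mult_of R)"
  by (rule group.group_comm_groupI[OF field_mult_group]) (auto intro: m_comm)

interpretation M: comm_group "mult_of R"
  by (rule field_mult_comm_group)

text \<open>The powers of \<open>\<theta>\<close> already provide \<open>N\<close> distinct
  \<open>N\<close>-th roots of unity, and a field has no more than that.\<close>

lemma root_of_unity_in_powers:
  assumes th: "\<theta> \<in> carrier (mult_of R)" and "group.ord (mult_of R) \<theta> = N" "N > 0"
    and x: "x \<in> carrier (mult_of R)" "x [^]\<^bsub>mult_of R\<^esub> N = \<one>"
  obtains k :: nat where "x = \<theta> [^]\<^bsub>mult_of R\<^esub> k"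
proof -
  let ?P = "(\<lambda>k. \<theta> [^]\<^bsub>mult_of R\<^esub> k) ` {0..N - 1}"
  let ?U = "{x \<in> carrier R. x [^] N = \<one>}"
  have "?P \<subseteq> ?U"
  proof clarify
    fix k :: nat
    have "(\<theta> [^]\<^bsub>mult_of R\<^esub> k) [^]\<^bsub>mult_of R\<^esub> N = \<one>\<^bsub>mult_of R\<^esub>"
      using M.nat_pow_pow[OF th] M.pow_eq_id[OF th] assms(2) by simp
    moreover have "\<theta> [^]\<^bsub>mult_of R\<^esub> k \<in> carrier (mult_of R)"
      using th by (rule M.nat_pow_closed)
    ultimately show "\<theta> [^]\<^bsub>mult_of R\<^esub> k \<in> carrier R \<and> (\<theta> [^]\<^bsub>mult_of R\<^esub> k) [^] N = \<one>"
      by (simp add: Multiplicative_Group.nat_pow_mult_of)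
  qed
  moreover have "card ?P = N"
    using M.ord_inj[OF th] assms(2,3) by (simp add: card_image)
  ultimately have "?P = ?U"
    using card_roots_of_unity_le[OF \<open>N > 0\<close>] by (intro card_seteq) auto
  moreover have "x \<in> ?U"
    using x by (simp add: Multiplicative_Group.nat_pow_mult_of)
  ultimately show ?thesis using that by blast
qed

text \<open>Let \<open>\<omega>\<close> have the largest order \<open>l ^ e\<close> among elements
  of \<open>l\<close>-power order; then \<open>l ^ e\<close> kills all of them. Lagrange gives
  \<open>e \<le> z\<close>. Conversely, a Sylow subgroup of the torsion has \<open>l ^ z\<close>
  elements, all of them roots of unity of exponent \<open>l ^ e\<close>, and there are at most
  \<open>l ^ e\<close> of these.\<close>

lemma prime_power_torsion_generator:
  assumes fin: "finite (torsion_set (mult_of R))" and l: "prime l"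
    and z: "z = multiplicity l (card (torsion_set (mult_of R)))"
  obtains \<omega> where "\<omega> \<in> carrier (mult_of R)" "group.ord (mult_of R) \<omega> = l ^ z"
    and "\<And>x k. \<lbrakk>x \<in> carrier (mult_of R); x [^]\<^bsub>mult_of R\<^esub> (l ^ k :: nat) = \<one>\<rbrakk>
      \<Longrightarrow> x [^]\<^bsub>mult_of R\<^esub> (l ^ z) = \<one>"
proof -
  let ?M = "mult_of R" and ?T = "torsion_set (mult_of R)"
  have T: "subgroup ?T ?M" by (rule M.subgroup_torsion_set)
  interpret T: group "?M\<lparr>carrier := ?T\<rparr>" by (rule M.subgroup_imp_group[OF T])
  have l1: "l > 1" using l by (rule prime_gt_1_nat)
  have T0: "card ?T > 0" using fin T subgroup.one_closed card_gt_0_iff by blast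
  define E where "E = {e. \<exists>x\<in>carrier ?M. M.ord x = l ^ e}"
  have dvd: "l ^ e dvd card ?T" if e: "e \<in> E" for e
  proof -
    obtain x where x: "x \<in> carrier ?M" "M.ord x = l ^ e" using e by (auto simp: E_def)
    have "0 < l ^ e" using l1 by simp
    moreover have "x [^]\<^bsub>?M\<^esub> (l ^ e) = \<one>\<^bsub>?M\<^esub>"
      using M.pow_ord_eq_1[OF x(1)] by (simp only: x(2))
    ultimately have "x \<in> ?T"
      using x(1) unfolding torsion_set_def by blast
    then have "subgroup (generate ?M {x}) (?M\<lparr>carrier := ?T\<rparr>)"
      using M.generate_is_subgroup[of "{x}"] M.generate_subgroup_incl[of "{x}", OF _ T] x(1) T
      by (intro M.subgroup_incl) auto
    then have "card (generate ?M {x}) dvd card ?T"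
      using T.lagrange[of "generate ?M {x}"] by (simp add: Coset.order_def) (metis dvd_triv_right)
    then show ?thesis using M.generate_pow_card[OF x(1)] x(2) by simp
  qed
  have E_le: "e \<le> z" if "e \<in> E" for e
    unfolding z using dvd[OF that] T0 l1 by (intro multiplicity_geI) auto
  then have finE: "finite E" by (meson finite_nat_set_iff_bounded_le)
  have "0 \<in> E" using M.ord_id M.one_closed by (force simp: E_def)
  define e where "e = Max E"
  have "e \<in> E" using finE \<open>0 \<in> E\<close> by (auto simp: e_def intro: Max_in)
  then obtain \<omega> where \<omega>: "\<omega> \<in> carrier ?M" "M.ord \<omega> = l ^ e" by (auto simp: E_def)
  have kill: "x [^]\<^bsub>?M\<^esub> (l ^ e) = \<one>"
    if "x \<in> carrier ?M" "x [^]\<^bsub>?M\<^esub> (l ^ k :: nat) = \<one>" for x k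
  proof -
    have "M.ord x dvd l ^ k" using that M.pow_eq_id[of x "l ^ k"] by simp
    then obtain j where "M.ord x = l ^ j" using l divides_primepow_nat by blast
    moreover have "j \<le> e"
      using finE that(1) calculation by (auto simp: e_def E_def intro: Max_ge)
    ultimately show ?thesis
      using M.pow_eq_id[OF that(1), of "l ^ e"] by (simp add: le_imp_power_dvd)
  qed
  obtain m where m: "card ?T = l ^ z * m"
    using multiplicity_dvd[of l "card ?T"] z by (auto elim: dvdE)
  obtain P where P: "subgroup P (?M\<lparr>carrier := ?T\<rparr>)" "card P = l ^ z"
    using sylow_thm[OF l T.is_group, of z m] m fin by (auto simp: Coset.order_def)
  have "P \<subseteq> {x \<in> carrier R. x [^] (l ^ e) = \<one>}"
  proof
    fix x assume "x \<in> P"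
    then have "x \<in> ?T" using subgroup.subset[OF P(1)] by auto
    then have x: "x \<in> carrier ?M" by (simp add: torsion_set_def)
    interpret P: group "?M\<lparr>carrier := ?T, carrier := P\<rparr>" by (rule T.subgroup_imp_group[OF P(1)])
    have "x [^]\<^bsub>?M\<lparr>carrier := ?T, carrier := P\<rparr>\<^esub> (l ^ z) = \<one>\<^bsub>?M\<lparr>carrier := ?T, carrier := P\<rparr>\<^esub>"
      using P.pow_order_eq_1[of x] \<open>x \<in> P\<close> P(2) by (simp add: Coset.order_def)
    then have "x [^]\<^bsub>?M\<^esub> (l ^ z) = \<one>"
      using M.nat_pow_consistent[of x "l ^ z" P] by simp
    then have "x [^]\<^bsub>?M\<^esub> (l ^ e) = \<one>" by (rule kill[OF x])
    then show "x \<in> {x \<in> carrier R. x [^] (l ^ e) = \<one>}"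
      using x by (simp add: Multiplicative_Group.nat_pow_mult_of)
  qed
  moreover have "l ^ e > 0" using l1 by simp
  ultimately have "card P \<le> l ^ e"
    using card_mono[OF card_roots_of_unity_le(1)] card_roots_of_unity_le(2) le_trans by blast
  then have "l ^ z \<le> l ^ e" by (simp only: P(2))
  then have "z \<le> e" using l1 by simp
  then have "e = z" using E_le[OF \<open>e \<in> E\<close>] by simp
  then show ?thesis using that \<omega> kill by blast
qed

text \<open>Both sides say that \<open>l ^ (z - n)\<close> kills the element \<theta> ^ k. If this
  element is c ^ (l ^ n), then \<open>c\<close> also has \<open>l\<close>-power order, so its order
  divides \<open>l ^ z\<close>. Conversely, the element is a power of \<open>\<omega>\<close>, and
  comparing orders shows that the exponent is divisible by \<open>l ^ n\<close> when
  \<open>n \<le> z\<close>.\<close>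

lemma root_of_unity_power_in_powers_iff:
  fixes k n :: nat
  assumes l: "l > 0"
    and \<omega>: "\<omega> \<in> carrier (mult_of R)" "group.ord (mult_of R) \<omega> = l ^ z"
    and kill: "\<And>x k. \<lbrakk>x \<in> carrier (mult_of R); x [^]\<^bsub>mult_of R\<^esub> (l ^ k :: nat) = \<one>\<rbrakk>
      \<Longrightarrow> x [^]\<^bsub>mult_of R\<^esub> (l ^ z) = \<one>"
    and \<theta>: "\<theta> \<in> carrier (mult_of R)" "group.ord (mult_of R) \<theta> = l ^ m"
  shows "\<theta> [^]\<^bsub>mult_of R\<^esub> k \<in> powers (mult_of R) (l ^ n) \<longleftrightarrow> l ^ (m - (z - n)) dvd k"
proof -
  let ?M = "mult_of R"
  let ?s = "l ^ (z - n)"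
  have iff: "l ^ (m - (z - n)) dvd k \<longleftrightarrow> (\<theta> [^]\<^bsub>?M\<^esub> k) [^]\<^bsub>?M\<^esub> ?s = \<one>"
    using M.pow_eq_id[OF \<theta>(1), of "k * ?s"] \<theta> prime_power_dvd_mult_iff[OF l, of m "z - n" k]
    by (simp add: M.nat_pow_pow mult.commute)
  have th_k: "\<theta> [^]\<^bsub>?M\<^esub> k \<in> carrier ?M" using \<theta>(1) by (rule M.nat_pow_closed)
  have th_m: "(\<theta> [^]\<^bsub>?M\<^esub> k) [^]\<^bsub>?M\<^esub> (l ^ m) = \<one>"
    using M.pow_eq_id[OF \<theta>(1), of "k * l ^ m"] \<theta> by (simp add: M.nat_pow_pow)
  show ?thesis
  proof
    assume "\<theta> [^]\<^bsub>?M\<^esub> k \<in> powers ?M (l ^ n)"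
    then obtain c where c: "c \<in> carrier ?M" "\<theta> [^]\<^bsub>?M\<^esub> k = c [^]\<^bsub>?M\<^esub> (l ^ n)"
      unfolding powers_def by blast
    have "c [^]\<^bsub>?M\<^esub> (l ^ (n + m)) = \<one>"
      using th_m by (simp only: c M.nat_pow_pow power_add)
    then have "c [^]\<^bsub>?M\<^esub> (l ^ z) = \<one>" by (rule kill[OF c(1)])
    then have "M.ord c dvd l ^ z" using M.pow_eq_id[OF c(1), of "l ^ z"] by simp
    also have "l ^ z dvd l ^ n * ?s" by (simp add: le_imp_power_dvd flip: power_add)
    finally have "c [^]\<^bsub>?M\<^esub> (l ^ n * ?s) = \<one>"
      using M.pow_eq_id[OF c(1), of "l ^ n * ?s"] by simp
    then show "l ^ (m - (z - n)) dvd k"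
      unfolding iff by (simp only: c M.nat_pow_pow)
  next
    assume "l ^ (m - (z - n)) dvd k"
    then have s1: "(\<theta> [^]\<^bsub>?M\<^esub> k) [^]\<^bsub>?M\<^esub> ?s = \<one>" unfolding iff .
    obtain a :: nat where a: "\<theta> [^]\<^bsub>?M\<^esub> k = \<omega> [^]\<^bsub>?M\<^esub> a"
      by (rule root_of_unity_in_powers[OF \<omega> zero_less_power[OF l] th_k kill[OF th_k th_m]])
    have "\<omega> [^]\<^bsub>?M\<^esub> (a * ?s) = \<one>"
      using s1 unfolding a M.nat_pow_pow[OF \<omega>(1)] .
    then have "l ^ z dvd ?s * a"
      using M.pow_eq_id[OF \<omega>(1), of "a * ?s"] \<omega>(2) by (simp add: mult.commute)
    then have "l ^ (z - (z - n)) dvd a" by (simp add: prime_power_dvd_mult_iff[OF l])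
    show "\<theta> [^]\<^bsub>?M\<^esub> k \<in> powers ?M (l ^ n)"
    proof (cases "n \<le> z")
      case True
      then have "l ^ n dvd a"
        using \<open>l ^ (z - (z - n)) dvd a\<close> by simp
      then obtain a' where "a = a' * l ^ n"
        by (metis dvd_def mult.commute)
      then have "\<theta> [^]\<^bsub>?M\<^esub> k = (\<omega> [^]\<^bsub>?M\<^esub> a') [^]\<^bsub>?M\<^esub> (l ^ n)"
        using \<omega>(1) by (simp add: a M.nat_pow_pow)
      then show ?thesis unfolding powers_def using M.nat_pow_closed[OF \<omega>(1)] by blast
    next
      \<comment> \<open>Now \<open>z - n\<close> is 0, so the assumption says that the element is
        1.\<close>
      case False
      then have "\<theta> [^]\<^bsub>?M\<^esub> k = \<one>\<^bsub>?M\<^esub>"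
        using s1 th_k by simp
      then show ?thesis by (simp only: subgroup.one_closed[OF M.subgroup_powers])
    qed
  qed
qed

text \<open>If the product is an \<open>l\<close>-th power up to a root of unity of
  \<open>l\<close>-power order, strong independence makes \<open>l\<close> divide every exponent.
  Dividing the exponents by \<open>l\<close> amounts to taking an \<open>l\<close>-th root of the
  equation, which lowers \<open>n\<close> by 1.\<close>

lemma strongly_independent_exponents:
  assumes l: "prime l" and B: "strongly_independent R l r B"
    and c: "c \<in> carrier (mult_of R)"
    and \<xi>: "\<xi> \<in> carrier (mult_of R)" "\<xi> [^]\<^bsub>mult_of R\<^esub> (l ^ k :: nat) = \<one>"
    and eq: "power_product (mult_of R) {1..r} B y = c [^]\<^bsub>mult_of R\<^esub> (l ^ n :: nat) \<otimes> \<xi>"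
    and i: "i \<in> {1..r}"
  shows "int l ^ n dvd y i"
  using \<xi> eq i
proof (induction n arbitrary: y \<xi> k)
  case (Suc n)
  let ?M = "mult_of R"
  have Bc: "B \<in> {1..r} \<rightarrow> carrier ?M" using B by (auto simp: strongly_independent_def)
  have cn: "c [^]\<^bsub>?M\<^esub> (l ^ n) \<in> carrier ?M" using c by (rule M.nat_pow_closed)
  have cSn: "c [^]\<^bsub>?M\<^esub> (l ^ Suc n) \<in> carrier ?M" using c by (rule M.nat_pow_closed)
  \<comment> \<open>The root of unity violating strong indivisibility is the inverse of
    \<open>\<xi>\<close>.\<close>
  have ind: "\<not> strongly_indivisible R l (power_product ?M {1..r} B y)"
  proof -
    have "power_product ?M {1..r} B y \<otimes> inv\<^bsub>?M\<^esub> \<xi> = c [^]\<^bsub>?M\<^esub> (l ^ Suc n)"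
      using M.m_assoc[OF cSn Suc.prems(1) M.inv_closed[OF Suc.prems(1)]]
        M.r_inv[OF Suc.prems(1)] M.r_one[OF cSn] Suc.prems(3)
      by simp
    also have "\<dots> = (c [^]\<^bsub>?M\<^esub> (l ^ n)) [^]\<^bsub>?M\<^esub> l"
      using c by (simp add: M.nat_pow_pow mult.commute)
    finally have "power_product ?M {1..r} B y \<otimes> inv\<^bsub>?M\<^esub> \<xi> \<in> powers ?M l"
      unfolding powers_def using cn by blast
    moreover have "\<exists>j. M.ord (inv\<^bsub>?M\<^esub> \<xi>) = l ^ j"
    proof -
      have "M.ord \<xi> dvd l ^ k" using Suc.prems(2) M.pow_eq_id[OF Suc.prems(1), of "l ^ k"] by simp
      then show ?thesis using l divides_primepow_nat M.ord_inv[OF Suc.prems(1)] by metis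
    qed
    ultimately show ?thesis
      unfolding strongly_indivisible_def using M.inv_closed[OF Suc.prems(1)] by blast
  qed
  then have "\<forall>i\<in>{1..r}. int l dvd y i"
    using B unfolding strongly_independent_def power_product_def by blast
  then have y: "y i = int l * (y i div int l)" if "i \<in> {1..r}" for i
    using that by simp
  define P where "P = power_product ?M {1..r} B (\<lambda>i. y i div int l)"
  \<comment> \<open>The discrepancy between the divided product and c ^ (l ^ n). It is an
    \<open>l\<close>-th root of \<open>\<xi>\<close>, so its order may be \<open>l\<close> times
    larger; this is why \<open>\<xi>\<close> and \<open>k\<close> vary in the induction.\<close>
  define \<eta> where "\<eta> = P \<otimes> inv\<^bsub>?M\<^esub> (c [^]\<^bsub>?M\<^esub> (l ^ n))"
  have P: "P \<in> carrier ?M" unfolding P_def by (rule M.power_product_closed[OF Bc])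
  have \<eta>: "\<eta> \<in> carrier ?M"
    using M.m_closed[OF P M.inv_closed[OF cn]] by (simp add: \<eta>_def)
  have "P [^]\<^bsub>?M\<^esub> int l = power_product ?M {1..r} B y"
    unfolding P_def M.power_product_pow[OF Bc] using y by (intro M.power_product_cong Bc) auto
  then have Pl: "P [^]\<^bsub>?M\<^esub> l = c [^]\<^bsub>?M\<^esub> (l ^ Suc n) \<otimes> \<xi>"
    using Suc.prems(3) by (simp add: int_pow_int)
  have Pe: "P = c [^]\<^bsub>?M\<^esub> (l ^ n) \<otimes> \<eta>"
    using M.m_comm[OF cn \<eta>] M.m_assoc[OF P M.inv_closed[OF cn] cn] M.l_inv[OF cn] M.r_one[OF P]
    by (simp add: \<eta>_def)
  have "c [^]\<^bsub>?M\<^esub> (l ^ Suc n) \<otimes>\<^bsub>?M\<^esub> \<eta> [^]\<^bsub>?M\<^esub> l = c [^]\<^bsub>?M\<^esub> (l ^ Suc n) \<otimes>\<^bsub>?M\<^esub> \<xi>"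
    using Pl M.nat_pow_distrib[OF cn \<eta>, of l] c by (simp add: Pe M.nat_pow_pow mult.commute)
  then have "\<eta> [^]\<^bsub>?M\<^esub> l = \<xi>"
    by (rule M.l_cancel[OF _ M.nat_pow_closed[OF \<eta>] Suc.prems(1) cSn])
  then have "\<eta> [^]\<^bsub>?M\<^esub> (l ^ Suc k) = \<one>"
    using M.nat_pow_pow[OF \<eta>, of l "l ^ k"] Suc.prems(2) by simp
  then have "int l ^ n dvd y i div int l"
    using Suc.IH[OF \<eta> _ Pe[unfolded P_def] Suc.prems(4)] by blast
  then show ?case using y[OF Suc.prems(4)] by (metis mult_dvd_mono dvd_refl power_Suc)
qed simp

end


section \<open>The group \<open>G / G\<^sub>n\<close>\<close>

theorem theorem3p5:
  fixes K :: "('a, 'b) ring_scheme"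
    and l r n z :: nat
    and G Gn :: "'a set"
    and Q :: "'a set monoid"
    and Hn :: "'a set set"
    and b B \<zeta> :: "nat \<Rightarrow> 'a"
    and d h \<delta> :: "nat \<Rightarrow> nat"
  assumes K: "number_field K"
    and l: "prime l"
    and G: "subgroup G (mult_of K)"
    and G_torsion_free: "torsion_free ((mult_of K)\<lparr>carrier := G\<rparr>)"
    and G_rank: "has_rank ((mult_of K)\<lparr>carrier := G\<rparr>) r"
    and r: "0 < r"
    and z: "z = multiplicity l (card (torsion_set (mult_of K)))"
    and G_gen: "G = generate (mult_of K) (b ` {1..r})"
    and B: "strongly_independent K l r B"
    and \<zeta>: "\<And>i. i \<in> {1..r} \<Longrightarrow>
               \<zeta> i \<in> carrier (mult_of K) \<and> group.ord (mult_of K) (\<zeta> i) = l ^ h i"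
    and b: "\<And>i. i \<in> {1..r} \<Longrightarrow> b i = B i [^]\<^bsub>K\<^esub> (l ^ d i) \<otimes>\<^bsub>K\<^esub> \<zeta> i"
    and \<delta>: "\<And>i. int (\<delta> i) = max (int n - int (d i)) 0"
    and Gn: "Gn = G \<inter> powers (mult_of K) (l ^ n)"
    and Q: "Q = ((mult_of K)\<lparr>carrier := G\<rparr>) Mod Gn"
    and Hn: "Hn = generate Q ((\<lambda>i. Gn #>\<^bsub>mult_of K\<^esub> (b i [^]\<^bsub>K\<^esub> (l ^ \<delta> i))) ` {1..r})"
  shows "finite Hn \<and> cyclic_group (Q\<lparr>carrier := Hn\<rparr>) \<and> (\<exists>k. card Hn = l ^ k) \<and>
     int (multiplicity l (card Hn)) =
       Max ((\<lambda>i. int (h i) - int (\<delta> i)) ` {1..r} \<union> {int z - int n, 0}) + min (int n - int z) 0 \<and>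
     Q Mod Hn \<cong> sum_group {1..r} (\<lambda>i. integer_mod_group (l ^ \<delta> i))"
proof -
  let ?M = "mult_of K" and ?I = "{1..r}"
  let ?G = "?M\<lparr>carrier := G\<rparr>"
  interpret K: field K using K by (simp add: number_field_def)
  interpret M: comm_group ?M by (rule K.field_mult_comm_group)
  interpret G: comm_group ?G  by (rule M.subgroup_imp_comm_group[OF G])
  have l0: "l > 0" and l1: "l > 1" using l prime_gt_0_nat[of l] prime_gt_1_nat[of l] by blast+
  obtain \<omega> where \<omega>: "\<omega> \<in> carrier ?M" "M.ord \<omega> = l ^ z"
    and kill: "\<And>x k. \<lbrakk>x \<in> carrier ?M; x [^]\<^bsub>?M\<^esub> (l ^ k :: nat) = \<one>\<^bsub>K\<^esub>\<rbrakk>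
      \<Longrightarrow> x [^]\<^bsub>?M\<^esub> (l ^ z) = \<one>\<^bsub>K\<^esub>"
    using K.prime_power_torsion_generator[OF number_field_finite_torsion[OF K] l z] by blast
  have B_closed: "B \<in> ?I \<rightarrow> carrier ?M" using B by (auto simp: strongly_independent_def)
  have \<zeta>_closed: "\<zeta> \<in> ?I \<rightarrow> carrier ?M" using \<zeta> by blast
  have b': "b i = B i [^]\<^bsub>?M\<^esub> (l ^ d i) \<otimes>\<^bsub>?M\<^esub> \<zeta> i" if "i \<in> ?I" for i
    using b[OF that] by (simp add: Multiplicative_Group.nat_pow_mult_of)
  have b_closed: "b \<in> ?I \<rightarrow> carrier ?M"
  proof
    fix i assume i: "i \<in> ?I"
    show "b i \<in> carrier ?M"
      unfolding b'[OF i] using B_closed \<zeta>_closed i by (intro M.m_closed M.nat_pow_closed) auto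
  qed
  have b_G: "b \<in> ?I \<rightarrow> G" using G_gen by (auto intro: generate.incl)
  have n_le: "n \<le> d i + \<delta> i" and \<delta>_eq: "\<delta> i = n - d i" for i
    using \<delta>[of i] by auto

  \<comment> \<open>Exponents of products of the \<open>b i\<close> that are \<open>l ^ n\<close>-th
    powers\<close>
  have PG: "power_product ?G ?I b x = power_product ?M ?I b x" for x
    by (rule M.power_product_subgroup[OF G b_G])

  have key: "\<forall>i\<in>?I. int (l ^ \<delta> i) dvd x i" if "power_product ?M ?I b x \<in> powers ?M (l ^ n)" for x
  proof
    fix i assume i: "i \<in> ?I"
    obtain c where c: "c \<in> carrier ?M" "power_product ?M ?I b x = c [^]\<^bsub>?M\<^esub> (l ^ n)"
      using \<open>power_product ?M ?I b x \<in> powers ?M (l ^ n)\<close> unfolding powers_def by blast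
    define \<xi> where "\<xi> = power_product ?M ?I \<zeta> x"
    have \<xi>: "\<xi> \<in> carrier ?M" unfolding \<xi>_def by (rule M.power_product_closed[OF \<zeta>_closed])
    \<comment> \<open>By \<open>kill\<close>, the single exponent \<open>l ^ z\<close> works for
      every \<open>\<zeta> i\<close>, and therefore for their product.\<close>
    have "\<xi> [^]\<^bsub>?M\<^esub> (l ^ z) = \<one>\<^bsub>K\<^esub>"
    proof -
      have "\<xi> [^]\<^bsub>?M\<^esub> int (l ^ z) = power_product ?M ?I (\<lambda>i. \<zeta> i [^]\<^bsub>?M\<^esub> int (l ^ z)) x"
        unfolding \<xi>_def M.power_product_pow[OF \<zeta>_closed]
        by (rule M.power_product_mult_exponents[OF \<zeta>_closed])
      also have "\<dots> = power_product ?M ?I (\<lambda>i. \<one>\<^bsub>?M\<^esub>) x"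
      proof (rule M.power_product_cong)
        fix i assume "i \<in> ?I"
        then have "\<zeta> i [^]\<^bsub>?M\<^esub> (l ^ h i) = \<one>\<^bsub>K\<^esub>"
          using \<zeta>[of i] M.pow_ord_eq_1[of "\<zeta> i"] by simp
        then show "\<zeta> i [^]\<^bsub>?M\<^esub> int (l ^ z) = \<one>\<^bsub>?M\<^esub>"
          using kill \<zeta>_closed \<open>i \<in> ?I\<close> by (simp only: int_pow_int Multiplicative_Group.one_mult_of Pi_iff)
      qed simp_all
      also have "\<dots> = \<one>\<^bsub>?M\<^esub>"
        unfolding power_product_def by (simp only: M.int_pow_one M.finprod_one)
      finally show ?thesis by (simp only: int_pow_int Multiplicative_Group.one_mult_of)
    qed
    \<comment> \<open>Expanding each \<open>b i\<close> leaves \<open>y i\<close> as the exponent of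
      \<open>B i\<close>. That \<open>l ^ n\<close> divides \<open>y i\<close> is equivalent to
      \<open>l ^ \<delta> i\<close> dividing \<open>x i\<close>.\<close>
    define y where "y i = int (l ^ d i) * x i" for i
    have "power_product ?M ?I b x
        = power_product ?M ?I (\<lambda>i. B i [^]\<^bsub>?M\<^esub> int (l ^ d i) \<otimes>\<^bsub>?M\<^esub> \<zeta> i) x"
      by (rule M.power_product_cong[OF _ refl b_closed, symmetric]) (simp only: b' int_pow_int)
    also have "\<dots> = power_product ?M ?I (\<lambda>i. B i [^]\<^bsub>?M\<^esub> int (l ^ d i)) x \<otimes>\<^bsub>?M\<^esub> \<xi>"
      unfolding \<xi>_def using B_closed
      by (intro M.power_product_mult \<zeta>_closed Pi_I M.int_pow_closed) blast
    also have "power_product ?M ?I (\<lambda>i. B i [^]\<^bsub>?M\<^esub> int (l ^ d i)) x = power_product ?M ?I B y"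
      unfolding y_def by (rule M.power_product_mult_exponents[OF B_closed, symmetric])
    finally have "power_product ?M ?I B y = c [^]\<^bsub>?M\<^esub> (l ^ n) \<otimes>\<^bsub>?M\<^esub> inv\<^bsub>?M\<^esub> \<xi>"
      using M.inv_solve_right[OF M.power_product_closed[OF B_closed] M.nat_pow_closed[OF c(1)] \<xi>] c(2)
      by simp
    moreover have "inv\<^bsub>?M\<^esub> \<xi> [^]\<^bsub>?M\<^esub> (l ^ z) = \<one>\<^bsub>K\<^esub>"
      using M.nat_pow_inv[OF \<xi>, of "l ^ z"] \<open>\<xi> [^]\<^bsub>?M\<^esub> (l ^ z) = \<one>\<^bsub>K\<^esub>\<close> M.inv_one by simp
    ultimately have "int l ^ n dvd y i"
      using K.strongly_independent_exponents[OF l B c(1) M.inv_closed[OF \<xi>] _ _ i] by simp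
    then show "int (l ^ \<delta> i) dvd x i"
      by (simp add: y_def \<delta>_eq int_power_dvd_mult_iff[OF l0])
  qed

  \<comment> \<open>Representatives of the generators of \<open>Hn\<close>, up to
    \<open>l ^ n\<close>-th powers\<close>
  define g where "g i = b i [^]\<^bsub>?M\<^esub> (l ^ \<delta> i)" for i
  define th where "th i = \<zeta> i [^]\<^bsub>?M\<^esub> (l ^ \<delta> i)" for i
  have th: "th i \<in> carrier ?M" "M.ord (th i) = l ^ (h i - \<delta> i)" if "i \<in> ?I" for i
    unfolding th_def using \<zeta>[OF that] M.ord_pow_prime_power[OF _ _ l0] M.nat_pow_closed by blast+
  have g_G: "g \<in> ?I \<rightarrow> G"
  proof
    fix i assume "i \<in> ?I"
    then have "b i [^]\<^bsub>?M\<^esub> int (l ^ \<delta> i) \<in> G"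
      using b_G by (intro M.subgroup_int_pow_closed[OF G]) auto
    then show "g i \<in> G" by (simp only: g_def int_pow_int)
  qed
  have g_th: "\<exists>u\<in>powers ?M (l ^ n). g i = u \<otimes>\<^bsub>?M\<^esub> th i" if i: "i \<in> ?I" for i
  proof
    have Bi: "B i \<in> carrier ?M" and \<zeta>i: "\<zeta> i \<in> carrier ?M" using B_closed \<zeta>_closed i by auto
    let ?u = "(B i [^]\<^bsub>?M\<^esub> (l ^ d i)) [^]\<^bsub>?M\<^esub> (l ^ \<delta> i)"
    show "g i = ?u \<otimes>\<^bsub>?M\<^esub> th i"
      unfolding g_def th_def b'[OF i] by (rule M.nat_pow_distrib[OF M.nat_pow_closed[OF Bi] \<zeta>i])
    have "l ^ d i * l ^ \<delta> i = l ^ (d i + \<delta> i - n) * l ^ n"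
      using n_le[of i] by (simp flip: power_add)
    then have "?u = (B i [^]\<^bsub>?M\<^esub> (l ^ (d i + \<delta> i - n))) [^]\<^bsub>?M\<^esub> (l ^ n)"
      by (simp only: M.nat_pow_pow[OF Bi])
    then show "?u \<in> powers ?M (l ^ n)"
      unfolding powers_def using M.nat_pow_closed[OF Bi] by blast
  qed

  \<comment> \<open>The quotient \<open>Q\<close> and its coset map\<close>
  let ?P = "powers ?M (l ^ n)"
  have P: "subgroup ?P ?M" by (rule M.subgroup_powers)
  have Gn_sub: "subgroup Gn ?G"
    unfolding Gn by (intro M.subgroup_incl M.subgroups_Inter_pair G P) auto
  interpret Q: comm_group Q unfolding Q by (rule G.abelian_FactGroup[OF Gn_sub])
  define cs where "cs a = Gn #>\<^bsub>?G\<^esub> a" for a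
  interpret cs: group_hom ?G Q cs
    unfolding Q cs_def
    by (intro group_hom.intro group_hom_axioms.intro G.is_group Q.is_group[unfolded Q]
        normal.r_coset_hom_Mod G.subgroup_imp_normal Gn_sub)
  have cs_surj: "cs ` G = carrier Q"
    by (auto simp: Q FactGroup_def RCOSETS_def cs_def)
  have cs_one: "cs a = \<one>\<^bsub>Q\<^esub> \<longleftrightarrow> a \<in> ?P" if "a \<in> G" for a
  proof -
    have "cs a = Gn \<longleftrightarrow> a \<in> Gn"
      using G.coset_join1[OF _ _ Gn_sub, of a] G.coset_join2[OF _ Gn_sub, of a] that
      by (auto simp: cs_def)
    then show ?thesis using that by (simp add: Q FactGroup_def Gn)
  qed
  have Hn_gen: "Hn = generate Q ((\<lambda>i. cs (g i)) ` ?I)"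
    unfolding Hn by (simp add: cs_def g_def r_coset_def Multiplicative_Group.nat_pow_mult_of)
  have g_carrier: "g \<in> ?I \<rightarrow> carrier ?G" and b_carrier: "b \<in> ?I \<rightarrow> carrier ?G"
    using g_G b_G by simp_all
  have csg: "(\<lambda>i. cs (g i)) ` ?I \<subseteq> carrier Q"
    using g_carrier cs.hom_closed by blast
  have Hn_sub: "subgroup Hn Q"
    unfolding Hn_gen by (rule Q.generate_is_subgroup[OF csg])

  \<comment> \<open>A cyclic generator of \<open>Hn\<close> and its order\<close>
  define m where "m = Max ((\<lambda>i. h i - \<delta> i) ` ?I)"
  have "m \<in> (\<lambda>i. h i - \<delta> i) ` ?I" unfolding m_def using r by (intro Max_in) auto
  \<comment> \<open>At \<open>i0\<close> the root of unity \<open>th i\<close> has the largest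
    order, namely \<open>l ^ m\<close>. As the differences are truncated, the maximum with 0 is
    already built into \<open>m\<close>.\<close>
  then obtain i0 where i0: "i0 \<in> ?I" "m = h i0 - \<delta> i0" by blast
  have m_max: "h i - \<delta> i \<le> m" if "i \<in> ?I" for i
    unfolding m_def using that by (intro Max_ge) auto
  have th0: "th i0 \<in> carrier ?M" "M.ord (th i0) = l ^ m" using th[OF i0(1)] i0(2) by simp_all
  obtain u0 where u0: "u0 \<in> ?P" "g i0 = u0 \<otimes>\<^bsub>?M\<^esub> th i0" using g_th[OF i0(1)] by blast
  have u0_closed: "u0 \<in> carrier ?M" using u0(1) subgroup.subset[OF P] by blast
  have pow_P: "u0 [^]\<^bsub>?M\<^esub> (k :: nat) \<in> ?P" for k
    using M.subgroup_int_pow_closed[OF P u0(1), of "int k"] by (simp only: int_pow_int)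
  have g0: "g i0 \<in> G" "g i0 \<in> carrier ?M" "g i0 \<in> carrier ?G"
    using g_G i0(1) subgroup.subset[OF G] by auto
  have g0_pow: "g i0 [^]\<^bsub>?M\<^esub> (k :: nat) = u0 [^]\<^bsub>?M\<^esub> k \<otimes>\<^bsub>?M\<^esub> th i0 [^]\<^bsub>?M\<^esub> k" for k
    unfolding u0(2) by (rule M.nat_pow_distrib[OF u0_closed th0(1)])
  define \<gamma> where "\<gamma> = cs (g i0)"
  have \<gamma>: "\<gamma> \<in> carrier Q" unfolding \<gamma>_def by (rule cs.hom_closed[OF g0(3)])
  have pow_G: "g i0 [^]\<^bsub>?M\<^esub> (k :: nat) \<in> G" for k
    using M.subgroup_int_pow_closed[OF G g0(1), of "int k"] by (simp only: int_pow_int)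
  have \<gamma>_pow: "\<gamma> [^]\<^bsub>Q\<^esub> (k :: nat) = cs (g i0 [^]\<^bsub>?M\<^esub> k)" for k
    unfolding \<gamma>_def cs.hom_nat_pow[OF g0(3), symmetric] by (simp only: M.nat_pow_consistent[of _ k G])
  have Hn_\<gamma>: "Hn = generate Q {\<gamma>}"
  proof
    show "generate Q {\<gamma>} \<subseteq> Hn"
      unfolding Hn_gen \<gamma>_def using i0(1) by (intro Q.mono_generate) auto
    have "cs (g i) \<in> generate Q {\<gamma>}" if i: "i \<in> ?I" for i
    proof -
      obtain u where u: "u \<in> ?P" "g i = u \<otimes>\<^bsub>?M\<^esub> th i" using g_th[OF i] by blast
      have u_closed: "u \<in> carrier ?M" using u(1) subgroup.subset[OF P] by blast
      have "th i [^]\<^bsub>?M\<^esub> (l ^ m) = \<one>\<^bsub>K\<^esub>"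
        using M.pow_eq_id[OF th(1)[OF i], of "l ^ m"] th(2)[OF i] m_max[OF i]
        by (simp add: le_imp_power_dvd)
      then obtain k :: nat where k: "th i = th i0 [^]\<^bsub>?M\<^esub> k"
        by (rule K.root_of_unity_in_powers[OF th0 zero_less_power[OF l0] th(1)[OF i]])
      \<comment> \<open>This \<open>l ^ n\<close>-th power is the factor by which \<open>g i\<close>
        differs from the \<open>k\<close>-th power of \<open>g i0\<close>. Since \<open>u\<close>
        and \<open>u0\<close> are not known to lie in \<open>G\<close>, membership of
        \<open>v\<close> in \<open>G\<close> is read off from that relation; only then does
        \<open>v\<close> have a trivial class in \<open>Q\<close>.\<close>
      define v where "v = u \<otimes>\<^bsub>?M\<^esub> inv\<^bsub>?M\<^esub> (u0 [^]\<^bsub>?M\<^esub> k)"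
      have v: "v \<in> ?P" unfolding v_def
        by (rule subgroup.m_closed[OF P u(1) subgroup.m_inv_closed[OF P pow_P]])
      have v_closed: "v \<in> carrier ?M" using v subgroup.subset[OF P] by blast
      have uk: "u0 [^]\<^bsub>?M\<^esub> k \<in> carrier ?M" and tk: "th i0 [^]\<^bsub>?M\<^esub> k \<in> carrier ?M"
        using M.nat_pow_closed u0_closed th0(1) by blast+
      have "v \<otimes>\<^bsub>?M\<^esub> u0 [^]\<^bsub>?M\<^esub> k = u"
        unfolding v_def M.m_assoc[OF u_closed M.inv_closed[OF uk] uk] M.l_inv[OF uk]
        by (rule M.r_one[OF u_closed])
      then have gi: "g i = v \<otimes>\<^bsub>?M\<^esub> g i0 [^]\<^bsub>?M\<^esub> k"
        unfolding g0_pow k u(2) using M.m_assoc[OF v_closed uk tk] by (simp only:)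
      have gk_closed: "g i0 [^]\<^bsub>?M\<^esub> k \<in> carrier ?M" by (rule M.nat_pow_closed[OF g0(2)])
      have giG: "g i \<in> G" using g_G i by blast
      then have gi_closed: "g i \<in> carrier ?M" using subgroup.subset[OF G] by blast
      have "v = g i \<otimes>\<^bsub>?M\<^esub> inv\<^bsub>?M\<^esub> (g i0 [^]\<^bsub>?M\<^esub> k)"
        using M.inv_solve_right[OF v_closed gi_closed gk_closed] gi by blast
      then have vG: "v \<in> G"
        using subgroup.m_closed[OF G giG subgroup.m_inv_closed[OF G pow_G]] by simp
      have "cs (g i) = cs v \<otimes>\<^bsub>Q\<^esub> cs (g i0 [^]\<^bsub>?M\<^esub> k)"
        using cs.hom_mult[of v "g i0 [^]\<^bsub>?M\<^esub> k"] vG pow_G by (simp add: gi)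
      also have "\<dots> = \<gamma> [^]\<^bsub>Q\<^esub> k"
        using v cs_one[OF vG] Q.nat_pow_closed[OF \<gamma>] by (simp flip: \<gamma>_pow)
      also have "\<dots> = \<gamma> [^]\<^bsub>Q\<^esub> int k" by (simp only: int_pow_int)
      finally show ?thesis unfolding Q.generate_pow[OF \<gamma>] by blast
    qed
    then show "Hn \<subseteq> generate Q {\<gamma>}"
      unfolding Hn_gen using \<gamma> by (intro Q.generate_subgroup_incl Q.generate_is_subgroup) auto
  qed
  \<comment> \<open>Powers of \<open>u0\<close> stay in \<open>?P\<close>, so a power of
    \<open>\<gamma>\<close> is trivial exactly when the same power of \<open>th i0\<close> is an
    \<open>l ^ n\<close>-th power. This is a question about roots of unity only.\<close>
  have ord_\<gamma>: "Q.ord \<gamma> = l ^ (m - (z - n))"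
    unfolding Q.ord_unique[OF \<gamma>]
  proof
    fix k :: nat
    have tk: "th i0 [^]\<^bsub>?M\<^esub> k \<in> carrier ?M" by (rule M.nat_pow_closed[OF th0(1)])
    have "\<gamma> [^]\<^bsub>Q\<^esub> k = \<one>\<^bsub>Q\<^esub> \<longleftrightarrow> u0 [^]\<^bsub>?M\<^esub> k \<otimes>\<^bsub>?M\<^esub> th i0 [^]\<^bsub>?M\<^esub> k \<in> ?P"
      unfolding \<gamma>_pow g0_pow[symmetric] by (rule cs_one[OF pow_G])
    also have "\<dots> \<longleftrightarrow> th i0 [^]\<^bsub>?M\<^esub> k \<in> ?P"
    proof
      have uk: "u0 [^]\<^bsub>?M\<^esub> k \<in> carrier ?M" by (rule M.nat_pow_closed[OF u0_closed])
      assume "u0 [^]\<^bsub>?M\<^esub> k \<otimes>\<^bsub>?M\<^esub> th i0 [^]\<^bsub>?M\<^esub> k \<in> ?P"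
      then have "inv\<^bsub>?M\<^esub> (u0 [^]\<^bsub>?M\<^esub> k) \<otimes>\<^bsub>?M\<^esub> (u0 [^]\<^bsub>?M\<^esub> k \<otimes>\<^bsub>?M\<^esub> th i0 [^]\<^bsub>?M\<^esub> k) \<in> ?P"
        by (rule subgroup.m_closed[OF P subgroup.m_inv_closed[OF P pow_P]])
      then show "th i0 [^]\<^bsub>?M\<^esub> k \<in> ?P"
        unfolding M.m_assoc[OF M.inv_closed[OF uk] uk tk, symmetric] M.l_inv[OF uk] M.l_one[OF tk] .
    qed (rule subgroup.m_closed[OF P pow_P])
    also have "\<dots> \<longleftrightarrow> l ^ (m - (z - n)) dvd k"
      by (rule K.root_of_unity_power_in_powers_iff[OF l0 \<omega> kill th0])
    finally show "\<gamma> [^]\<^bsub>Q\<^esub> k = \<one>\<^bsub>Q\<^esub> \<longleftrightarrow> l ^ (m - (z - n)) dvd k" .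
  qed
  have card_Hn: "card Hn = l ^ (m - (z - n))"
    unfolding Hn_\<gamma> Q.generate_pow_card[OF \<gamma>, symmetric] by (rule ord_\<gamma>)
  have fin_Hn: "finite Hn"
    by (rule card_ge_0_finite) (simp add: card_Hn l0)
  have cyc: "cyclic_group (Q\<lparr>carrier := Hn\<rparr>)"
  proof -
    have "Q\<lparr>carrier := Hn\<rparr> = subgroup_generated Q {\<gamma>}"
      using \<gamma> by (simp add: subgroup_generated_def Hn_\<gamma>)
    then show ?thesis using Q.cyclic_group_generated by simp
  qed

  \<comment> \<open>The valuation formula\<close>
  have mult: "int (multiplicity l (card Hn)) =
      Max ((\<lambda>i. int (h i) - int (\<delta> i)) ` ?I \<union> {int z - int n, 0}) + min (int n - int z) 0"
  proof -
    \<comment> \<open>The entry 0 in the integer maximum matches the truncation in \<open>m\<close>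
      and in \<open>z - n\<close>.\<close>
    have "Max ((\<lambda>i. int (h i) - int (\<delta> i)) ` ?I \<union> {int z - int n, 0}) = int (max m (z - n))"
    proof (rule Max_eqI)
      fix y assume "y \<in> (\<lambda>i. int (h i) - int (\<delta> i)) ` ?I \<union> {int z - int n, 0}"
      then consider i where "i \<in> ?I" "y = int (h i) - int (\<delta> i)" | "y = int z - int n" | "y = 0"
        by blast
      then show "y \<le> int (max m (z - n))"
      proof cases
        case 1
        then show ?thesis using m_max[of i] by linarith
      qed auto
    next
      let ?A = "(\<lambda>i. int (h i) - int (\<delta> i)) ` ?I"
      have "{int (h i0) - int (\<delta> i0), int z - int n, 0} \<subseteq> ?A \<union> {int z - int n, 0}"
        by (rule insert_subsetI[OF UnI1[OF imageI[OF i0(1)]] Un_upper2])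
      moreover have "int (max m (z - n)) \<in> {int (h i0) - int (\<delta> i0), int z - int n, 0}"
        unfolding i0(2) by auto
      ultimately show "int (max m (z - n)) \<in> ?A \<union> {int z - int n, 0}"
        by (rule subsetD)
    qed simp
    moreover have "multiplicity l (card Hn) = m - (z - n)"
      unfolding card_Hn using l1 by (simp add: multiplicity_same_power)
    \<comment> \<open>The summand with \<open>min\<close> is minus the truncated
      \<open>z - n\<close>; both sides are the larger of \<open>m\<close> and \<open>z - n\<close>,
      reduced by \<open>z - n\<close>.\<close>
    moreover have "int (m - (z - n)) = int (max m (z - n)) + min (int n - int z) 0"
      by linarith
    ultimately show ?thesis by (simp only:)
  qed

  \<comment> \<open>Exponent vectors as coordinates on \<open>Q\<close> and on
    \<open>Hn\<close>\<close>
  define F where "F x = cs (power_product ?G ?I b x)" for x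
  have pp_G: "power_product ?G ?I b x \<in> carrier ?G" for x
    by (rule G.power_product_closed[OF b_carrier])
  have F_closed: "F x \<in> carrier Q" for x
    unfolding F_def by (rule cs.hom_closed[OF pp_G])
  have F_add: "F (\<lambda>i. x i + y i) = F x \<otimes>\<^bsub>Q\<^esub> F y" for x y
    unfolding F_def G.power_product_add[OF b_carrier] by (rule cs.hom_mult[OF pp_G pp_G])
  have range_F: "range F = carrier Q"
  proof -
    have "G = generate ?G (b ` ?I)"
      using G_gen b_G M.generate_consistent[OF _ G] by blast
    also have "\<dots> = range (power_product ?G ?I b)"
      by (rule G.generate_eq_range_power_product[OF finite_atLeastAtMost b_carrier])
    finally have "range (power_product ?G ?I b) = G" ..
    then show ?thesis by (simp add: F_def cs_surj flip: image_image)
  qed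
  have Hn_F: "Hn = range (\<lambda>y. F (\<lambda>i. int (l ^ \<delta> i) * y i))"
  proof -
    have "power_product ?G ?I (\<lambda>i. b i [^]\<^bsub>?G\<^esub> int (l ^ \<delta> i)) y = power_product ?G ?I g y" for y
      by (rule G.power_product_cong[OF _ refl g_carrier])
        (simp only: g_def int_pow_int M.nat_pow_consistent[of _ _ G])
    then have "F (\<lambda>i. int (l ^ \<delta> i) * y i) = cs (power_product ?G ?I g y)" for y
      unfolding F_def G.power_product_mult_exponents[OF b_carrier] by simp
    then have "range (\<lambda>y. F (\<lambda>i. int (l ^ \<delta> i) * y i)) = cs ` range (power_product ?G ?I g)"
      by (simp add: image_image)
    also have "\<dots> = cs ` generate ?G (g ` ?I)"
      by (simp only: G.generate_eq_range_power_product[OF finite_atLeastAtMost g_carrier])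
    also have "\<dots> = generate Q (cs ` g ` ?I)"
      using g_carrier by (intro cs.generate_img[symmetric]) blast
    finally show ?thesis unfolding Hn_gen by (simp only: image_image)
  qed
  have F_Hn: "F x \<in> Hn \<longleftrightarrow> (\<forall>i\<in>?I. int (l ^ \<delta> i) dvd x i)" for x
  proof
    assume "F x \<in> Hn"
    then obtain y where y: "F x = F (\<lambda>i. int (l ^ \<delta> i) * y i)" unfolding Hn_F by blast
    \<comment> \<open>The difference of two vectors with the same image lies in the kernel of
      \<open>F\<close>, where \<open>key\<close> applies.\<close>
    define w where "w i = x i - int (l ^ \<delta> i) * y i" for i
    have "F x = F w \<otimes>\<^bsub>Q\<^esub> F (\<lambda>i. int (l ^ \<delta> i) * y i)"
      unfolding F_add[symmetric] by (simp add: w_def)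
    then have "F w = \<one>\<^bsub>Q\<^esub>"
      using y F_closed by (metis Q.r_cancel_one)
    then have "power_product ?M ?I b w \<in> ?P"
      unfolding PG[symmetric] using cs_one pp_G[of w] by (simp add: F_def)
    then have "\<forall>i\<in>?I. int (l ^ \<delta> i) dvd w i" by (rule key)
    then have "\<forall>i\<in>?I. int (l ^ \<delta> i) dvd w i + int (l ^ \<delta> i) * y i" by auto
    then show "\<forall>i\<in>?I. int (l ^ \<delta> i) dvd x i" by (simp add: w_def)
  next
    assume x: "\<forall>i\<in>?I. int (l ^ \<delta> i) dvd x i"
    have "F x = F (\<lambda>i. int (l ^ \<delta> i) * (x i div int (l ^ \<delta> i)))"
      unfolding F_def using x b_carrier by (intro arg_cong[of _ _ cs] G.power_product_cong) auto
    then show "F x \<in> Hn"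
      unfolding Hn_F by (rule range_eqI[of _ _ "\<lambda>i. x i div int (l ^ \<delta> i)"])
  qed

  \<comment> \<open>The quotient of \<open>Q\<close> by \<open>Hn\<close>\<close>
  let ?S = "sum_group ?I (\<lambda>i. integer_mod_group (l ^ \<delta> i))"
  have Hn_normal: "Hn \<lhd> Q" by (rule Q.subgroup_imp_normal[OF Hn_sub])
  \<comment> \<open>The kernel of \<open>q\<close> consists of the \<open>x\<close> with
    \<open>F x\<close> in \<open>Hn\<close>; by \<open>F_Hn\<close> this is also the kernel of
    coordinatewise reduction modulo \<open>l ^ \<delta> i\<close>.\<close>
  define q where "q x = Hn #>\<^bsub>Q\<^esub> F x" for x
  have "Q Mod Hn \<cong> ?S"
  proof (rule iso_of_surj_homs_same_kernel)
    show "group (int_functions :: (nat \<Rightarrow> int) monoid)" by simp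
    show "group (Q Mod Hn)" by (rule normal.factorgroup_is_group[OF Hn_normal])
    show "group ?S" by simp
    show "q \<in> hom int_functions (Q Mod Hn)"
      using normal.r_coset_hom_Mod[OF Hn_normal] F_closed
      by (auto simp: hom_def q_def F_add Pi_iff)
    show "(\<lambda>x. \<lambda>i\<in>?I. x i mod int (l ^ \<delta> i)) \<in> hom int_functions ?S"
      using l0 by (intro sum_group_integer_mod_group_proj) auto
    have "q ` UNIV = (\<lambda>a. Hn #>\<^bsub>Q\<^esub> a) ` carrier Q"
      unfolding range_F[symmetric] by (simp add: q_def image_image)
    then show "q ` carrier int_functions = carrier (Q Mod Hn)"
      by (auto simp: FactGroup_def RCOSETS_def)
    show "(\<lambda>x. \<lambda>i\<in>?I. x i mod int (l ^ \<delta> i)) ` carrier int_functions = carrier ?S"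
      using l0 sum_group_integer_mod_group_proj(2)[of ?I "\<lambda>i. l ^ \<delta> i"] by simp
    have "kernel int_functions (Q Mod Hn) q = {x. F x \<in> Hn}"
      using Q.coset_join1[OF _ F_closed Hn_sub] Q.coset_join2[OF F_closed Hn_sub]
      by (auto simp: kernel_def q_def FactGroup_def)
    also have "\<dots> = kernel int_functions ?S (\<lambda>x. \<lambda>i\<in>?I. x i mod int (l ^ \<delta> i))"
      using l0 sum_group_integer_mod_group_proj(3)[of ?I "\<lambda>i. l ^ \<delta> i"] by (simp add: F_Hn)
    finally show "kernel int_functions (Q Mod Hn) q =
        kernel int_functions ?S (\<lambda>x. \<lambda>i\<in>?I. x i mod int (l ^ \<delta> i))" .
  qed
  then show ?thesis using fin_Hn cyc card_Hn mult by blast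
qed

end
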